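(* Let $T_1,T_2$ be trees with $n$ vertices such that $T_2$ covers $T_1$ in $\mathsf{GTS}_n$. Then for all $q\in\mathbb{R}\setminus\{0\}$, $\lambda_{\max}(\mathcal{L}_{T_1}^q)\le\lambda_{\max}(\mathcal{L}_{T_2}^q)$. In particular, for any tree $T$ with $n$ vertices, $\lambda_{\max}(\mathcal{L}_{P_n}^q)\le\lambda_{\max}(\mathcal{L}_T^q)\le\lambda_{\max}(\mathcal{L}_{S_n}^q)$.
   Context: For a tree $T$ with degree diagonal matrix $D$ and adjacency matrix $A$, $\mathcal{L}_T^q=I+q^2(D-I)-qA$; $\lambda_{\max}$ is its largest eigenvalue. $P_n$ and $S_n$ are the path and the star on $n$ vertices. Generalized tree shift: for a tree $T$ and distinct vertices $u,w$ such that each internal vertex of the $u$–$w$ path $P$ has degree 2, with $w'$ the neighbour of $w$ on $P$, replace each edge $\{w,z\}$, $z\ne w'$, by $\{u,z\}$. $\mathsf{GTS}_n$: partial order on isomorphism classes of $n$-vertex trees, $T_1\le T_2$ iff $T_2$ arises from $T_1$ by finitely many generalized tree shifts; $T_2$ covers $T_1$ if $T_1\le T_2$, $T_1\ne T_2$, and no tree lies strictly between them. *)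

theory Defs
  imports "Graph_Theory.Graph_Theory" "Jordan_Normal_Form.Char_Poly"
begin

text \<open>
  Undirected simple graphs are symmetric loop-free digraphs, each edge \<open>{u, v}\<close> being the pair of
  arcs \<open>(u, v)\<close>, \<open>(v, u)\<close>. Trees on \<open>n\<close> vertices are represented by trees with vertex set
  \<open>{0..<n}\<close>. The library constants \<open>forest\<close> and \<open>tree\<close> cannot be used here, since they count the
  back-and-forth walk along a single edge as a cycle; cycles of a simple graph have length at
  least 3.
\<close>
definition tree_on :: "nat \<Rightarrow> nat pair_pre_digraph \<Rightarrow> bool" where
  "tree_on n T \<longleftrightarrow> pverts T = {0..<n} \<and> pair_graph T \<and> connected T
     \<and> \<not> (\<exists>p. pre_digraph.cycle T p \<and> 3 \<le> length p)"

definition path_tree :: "nat \<Rightarrow> nat pair_pre_digraph" where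
  "path_tree n = \<lparr>pverts = {0..<n},
     parcs = {(i, j). i < n \<and> j < n \<and> (j = Suc i \<or> i = Suc j)}\<rparr>"

definition star_tree :: "nat \<Rightarrow> nat pair_pre_digraph" where
  "star_tree n = \<lparr>pverts = {0..<n},
     parcs = {(i, j). i < n \<and> j < n \<and> i \<noteq> j \<and> (i = 0 \<or> j = 0)}\<rparr>"

definition degree_mat :: "nat \<Rightarrow> nat pair_pre_digraph \<Rightarrow> real mat" where
  "degree_mat n T = mat_diag n (\<lambda>i. real (out_degree T i))"

definition adjacency_mat :: "nat \<Rightarrow> nat pair_pre_digraph \<Rightarrow> real mat" where
  "adjacency_mat n T = mat n n (\<lambda>(i, j). if (i, j) \<in> parcs T then 1 else 0)"

definition q_laplacian :: "nat \<Rightarrow> real \<Rightarrow> nat pair_pre_digraph \<Rightarrow> real mat" where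
  "q_laplacian n q T =
     1\<^sub>m n + q\<^sup>2 \<cdot>\<^sub>m (degree_mat n T - 1\<^sub>m n) - q \<cdot>\<^sub>m adjacency_mat n T"

definition lambda_max :: "real mat \<Rightarrow> real" where
  "lambda_max M = Max {k. eigenvalue M k}"

text \<open>\<open>w'\<close> is the neighbour of \<open>w\<close> on the path from \<open>u\<close> to \<open>w\<close>.\<close>
definition shift_edges :: "'a pair_pre_digraph \<Rightarrow> 'a \<Rightarrow> 'a \<Rightarrow> 'a \<Rightarrow> 'a pair_pre_digraph" where
  "shift_edges T u w w' =
     (let Z = {z. (w, z) \<in> parcs T \<and> z \<noteq> w'} in
      \<lparr>pverts = pverts T,
       parcs = (parcs T - ({w} \<times> Z \<union> Z \<times> {w})) \<union> ({u} \<times> Z \<union> Z \<times> {u})\<rparr>)"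

text \<open>A path \<open>p\<close> is a list of arcs, so the neighbour of its endpoint is the tail of its last arc.\<close>
definition gen_tree_shift :: "'a pair_pre_digraph \<Rightarrow> 'a pair_pre_digraph \<Rightarrow> bool" where
  "gen_tree_shift T T' \<longleftrightarrow> (\<exists>u w p. u \<noteq> w \<and> pre_digraph.apath T u p w
     \<and> (\<forall>v \<in> set (pre_digraph.inner_verts T p). out_degree T v = 2)
     \<and> T' = shift_edges T u w (fst (last p)))"

lemma digraph_iso_pair_iff:
  fixes T1 T2 :: "'a pair_pre_digraph"
  assumes "pair_wf_digraph T1"
  shows "digraph_iso T1 T2 \<longleftrightarrow>
    (\<exists>f. bij_betw f (pverts T1) (pverts T2) \<and> parcs T2 = map_prod f f ` parcs T1)"
proof
  interpret pair_wf_digraph T1 by fact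
  assume "digraph_iso T1 T2"
  then obtain h where h: "digraph_isomorphism h" and e: "with_proj T2 = app_iso h T1"
    by (auto simp: digraph_iso_def)
  let ?f = "iso_verts h"
  have t: "iso_tail h = fst" "iso_head h = snd" "pverts T2 = ?f ` pverts T1"
    "parcs T2 = iso_arcs h ` parcs T1"
    using e by (simp_all add: app_iso_def with_proj_def)
  have *: "iso_arcs h a = map_prod ?f ?f a" if "a \<in> parcs T1" for a
    using h that unfolding pre_digraph.digraph_isomorphism_def
    by (auto simp: t prod_eq_iff)
  have "bij_betw ?f (pverts T1) (pverts T2)"
    using h t by (simp add: pre_digraph.digraph_isomorphism_def bij_betw_def)
  moreover have "parcs T2 = map_prod ?f ?f ` parcs T1"
    unfolding t by (rule image_cong) (auto simp: *)
  ultimately show "\<exists>f. bij_betw f (pverts T1) (pverts T2) \<and> parcs T2 = map_prod f f ` parcs T1"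
    by blast
next
  interpret pair_wf_digraph T1 by fact
  assume "\<exists>f. bij_betw f (pverts T1) (pverts T2) \<and> parcs T2 = map_prod f f ` parcs T1"
  then obtain f where f: "bij_betw f (pverts T1) (pverts T2)"
    and p: "parcs T2 = map_prod f f ` parcs T1" by blast
  let ?h = "\<lparr>iso_verts = f, iso_arcs = map_prod f f, iso_head = snd, iso_tail = fst\<rparr>"
  have "parcs T1 \<subseteq> pverts T1 \<times> pverts T1"
    by (auto dest: in_arcsD1 in_arcsD2)
  then have "inj_on (map_prod f f) (parcs T1)"
    using f by (rule_tac inj_on_subset[OF map_prod_inj_on]) (auto simp: bij_betw_def)
  then have "digraph_isomorphism ?h"
    using f wf_digraph unfolding pre_digraph.digraph_isomorphism_def by (auto simp: bij_betw_def)
  moreover have "with_proj T2 = app_iso ?h T1"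
    using f p by (simp add: app_iso_def with_proj_def bij_betw_def)
  ultimately show "digraph_iso T1 T2" by (auto simp: digraph_iso_def)
qed

text \<open>
  The poset lives on isomorphism classes; the relations below are on representatives, with
  isomorphism in the role of equality.
\<close>
definition gts_le :: "'a pair_pre_digraph \<Rightarrow> 'a pair_pre_digraph \<Rightarrow> bool" where
  "gts_le T1 T2 \<longleftrightarrow> (\<exists>T. gen_tree_shift\<^sup>*\<^sup>* T1 T \<and> digraph_iso T T2)"

definition gts_less :: "'a pair_pre_digraph \<Rightarrow> 'a pair_pre_digraph \<Rightarrow> bool" where
  "gts_less T1 T2 \<longleftrightarrow> gts_le T1 T2 \<and> \<not> digraph_iso T1 T2"

definition gts_covers :: "nat \<Rightarrow> nat pair_pre_digraph \<Rightarrow> nat pair_pre_digraph \<Rightarrow> bool" where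
  "gts_covers n T1 T2 \<longleftrightarrow> gts_less T1 T2
     \<and> \<not> (\<exists>T. tree_on n T \<and> gts_less T1 T \<and> gts_less T T2)"

end

(*
  For a tree the sign of q is irrelevant, because trees are bipartite: lambda_max is the maximum of
    Q(x) = (1 - q^2) sum_v x_v^2 + sum_{edges ab} (q^2 (x_a^2 + x_b^2) + 2 |q| x_a x_b)
  over nonnegative unit vectors x, and every edge term increases with its endpoint values.

  Generalized tree shift from w to u: if x_u >= x_w, then Q(x) does not decrease when the branches
  at w are moved to u. Otherwise reverse the values of x along the path from u to w, so that all
  branches, which are now collected at u, see the larger value x_w.

  The path is reached from any tree by inverse shifts, each destroying a leaf. For the star, the
  Collatz-Wielandt bound applies to a positive vector y that is affine in the degree: the
  inequality Q y <= lambda y becomes quadratic in the degree d, with equality at d = 1 and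
  d = n - 1, where it is the eigenvalue equation of the star. It only uses that the degrees of
  the neighbours of a vertex add up to at most n - 1.
*)
theory Submission
  imports Defs "HOL-Analysis.Function_Topology"
begin

subsection \<open>The largest eigenvalue of a symmetric matrix\<close>

text \<open>Trees are handled as a root with a parent function, because a shift then only changes
  values of that function: with the target \<open>u\<close> as root, the children of
  \<open>w\<close> receive the parent \<open>u\<close>. Edges are indexed by the non-root vertices
  both before and after, so energies can be compared term by term. In the reversal case the path
  edges are permuted and only their total is compared. Degree 2 inside the path guarantees that no
  other edge hangs on an inner vertex, where the value may drop. The affine vector for the star
  interpolates the star's own eigenvector, which is \<open>m\<close> at the centre and
  \<open>c = \<bar>q\<bar>\<close> at the leaves.\<close>

lemma compact_unit_sphere_fun:
  "compact {x :: nat \<Rightarrow> real. (\<forall>i\<ge>n. x i = 0) \<and> (\<Sum>i<n. (x i)\<^sup>2) = 1}" (is "compact ?S")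
proof -
  \<comment> \<open>Vectors are functions on all of \<open>nat\<close>; pinning the coordinates from
    \<open>n\<close> on to 0 places the sphere in a product of compact sets, so Tychonoff
    applies.\<close>
  let ?B = "PiE UNIV (\<lambda>i. if i < n then {-1..1} else {0::real})"
  have "compactin (product_topology (\<lambda>_. euclidean) UNIV) ?B"
    by (subst compactin_PiE) auto
  then have B: "compact ?B"
    by (simp add: euclidean_product_topology)
  have "closed {x :: nat \<Rightarrow> real. (\<Sum>i<n. (x i)\<^sup>2) = 1}"
    by (intro closed_Collect_eq continuous_intros continuous_on_product_coordinates)
  then have "compact (?B \<inter> {x. (\<Sum>i<n. (x i)\<^sup>2) = 1})"
    by (rule compact_Int_closed[OF B])
  moreover have "?S = ?B \<inter> {x. (\<Sum>i<n. (x i)\<^sup>2) = 1}"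
  proof (intro equalityI subsetI)
    fix x assume x: "x \<in> ?S"
    have "x i \<in> {-1..1}" if "i < n" for i
    proof -
      have "(x i)\<^sup>2 \<le> (\<Sum>i<n. (x i)\<^sup>2)"
        using that by (intro member_le_sum) auto
      then show ?thesis using x by (simp add: abs_square_le_1 abs_le_iff)
    qed
    then show "x \<in> ?B \<inter> {x. (\<Sum>i<n. (x i)\<^sup>2) = 1}" using x by auto
  next
    fix x assume x: "x \<in> ?B \<inter> {x. (\<Sum>i<n. (x i)\<^sup>2) = 1}"
    have "x i = 0" if "i \<ge> n" for i
      using x that PiE_mem[of x UNIV _ i] by (auto split: if_splits)
    then show "x \<in> ?S" using x by auto
  qed
  ultimately show ?thesis by simp
qed

lemma rayleigh_maximum_exists:
  fixes a :: "nat \<Rightarrow> nat \<Rightarrow> real"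
  assumes "n > 0"
  obtains x l where "(\<Sum>i<n. (x i)\<^sup>2) = 1" "(\<Sum>i<n. \<Sum>j<n. a i j * x i * x j) = l"
    "\<And>y. (\<Sum>i<n. \<Sum>j<n. a i j * y i * y j) \<le> l * (\<Sum>i<n. (y i)\<^sup>2)"
proof -
  let ?S = "{x :: nat \<Rightarrow> real. (\<forall>i\<ge>n. x i = 0) \<and> (\<Sum>i<n. (x i)\<^sup>2) = 1}"
  let ?f = "\<lambda>x. \<Sum>i<n. \<Sum>j<n. a i j * x i * x j"
  have "(\<Sum>i<n. (if i = 0 then 1 else 0 :: real)\<^sup>2) = (\<Sum>i<n. if i = 0 then 1 else 0)"
    by (intro sum.cong) auto
  then have "(\<lambda>i. if i = 0 then 1 else 0) \<in> ?S"
    using assms by simp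
  then have "?S \<noteq> {}" by (rule ex_in_conv[THEN iffD1, OF exI])
  moreover have "continuous_on ?S ?f"
    by (intro continuous_intros continuous_on_product_then_coordinatewise continuous_on_id)
  ultimately have "\<exists>x\<in>?S. \<forall>y\<in>?S. ?f y \<le> ?f x"
    by (rule continuous_attains_sup[OF compact_unit_sphere_fun])
  then obtain x where x: "x \<in> ?S" and max: "\<And>y. y \<in> ?S \<Longrightarrow> ?f y \<le> ?f x"
    by (elim bexE) simp
  have "?f y \<le> ?f x * (\<Sum>i<n. (y i)\<^sup>2)" for y
  proof (cases "\<forall>i<n. y i = 0")
    case False
    define s where "s = (\<Sum>i<n. (y i)\<^sup>2)"
    have "s > 0"
      unfolding s_def using False by (auto intro!: sum_pos2)
    define z where "z = (\<lambda>i. if i < n then y i / sqrt s else 0)"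
    have "(\<Sum>i<n. (z i)\<^sup>2) = (\<Sum>i<n. (y i)\<^sup>2 / s)"
      using \<open>s > 0\<close> by (intro sum.cong) (auto simp: z_def power_divide)
    also have "\<dots> = 1"
      using \<open>s > 0\<close> by (simp add: s_def flip: sum_divide_distrib)
    finally have "?f z \<le> ?f x" by (intro max) (simp add: z_def)
    moreover have "?f z = (\<Sum>i<n. \<Sum>j<n. a i j * y i * y j / s)"
      using \<open>s > 0\<close> by (intro sum.cong) (auto simp: z_def)
    then have "?f z = ?f y / s"
      by (simp add: sum_divide_distrib)
    ultimately show ?thesis
      using \<open>s > 0\<close> by (simp add: s_def divide_le_eq)
  qed simp
  with x show ?thesis by (intro that[of x "?f x"]) auto
qed

text \<open>Along the \<open>k\<close>-th unit vector, \<open>l\<close> times the squared norm minus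
  the form is a quadratic polynomial in the step \<open>t\<close> that is nonnegative and vanishes
  at 0; hence its linear coefficient \<open>2 * b\<close> is 0.\<close>

lemma rayleigh_maximum_eigenvector:
  fixes a :: "nat \<Rightarrow> nat \<Rightarrow> real"
  assumes sym: "\<And>i j. i < n \<Longrightarrow> j < n \<Longrightarrow> a i j = a j i"
    and eq: "(\<Sum>i<n. \<Sum>j<n. a i j * x i * x j) = l * (\<Sum>i<n. (x i)\<^sup>2)"
    and le: "\<And>y. (\<Sum>i<n. \<Sum>j<n. a i j * y i * y j) \<le> l * (\<Sum>i<n. (y i)\<^sup>2)"
    and "k < n"
  shows "(\<Sum>j<n. a k j * x j) = l * x k"
proof -
  define b where "b = l * x k - (\<Sum>j<n. a k j * x j)"
  have pert: "0 \<le> 2 * t * b + t\<^sup>2 * (l - a k k)" for t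
  proof -
    define e :: "nat \<Rightarrow> real" where "e i = (if i = k then t else 0)" for i
    have e1: "(\<Sum>i<n. f i * e i) = f k * t" for f
      using \<open>k < n\<close> by (simp add: e_def if_distrib sum.delta cong: if_cong)
    have "(\<Sum>i<n. \<Sum>j<n. a i j * (x i + e i) * (x j + e j)) =
      (\<Sum>i<n. \<Sum>j<n. a i j * x i * x j) + (\<Sum>i<n. \<Sum>j<n. a i j * x i * e j)
       + (\<Sum>i<n. (\<Sum>j<n. a i j * x j) * e i) + (\<Sum>i<n. (\<Sum>j<n. a i j * e j) * e i)"
      by (simp add: algebra_simps sum.distrib sum_distrib_left sum_distrib_right)
    also have "(\<Sum>i<n. \<Sum>j<n. a i j * x i * e j) = (\<Sum>j<n. a k j * x j) * t"
      using sym \<open>k < n\<close> by (simp add: e1 sum_distrib_right)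
    finally have A: "(\<Sum>i<n. \<Sum>j<n. a i j * (x i + e i) * (x j + e j)) =
      (\<Sum>i<n. \<Sum>j<n. a i j * x i * x j) + 2 * t * (\<Sum>j<n. a k j * x j) + t\<^sup>2 * a k k"
      by (simp add: e1 power2_eq_square)
    have "(\<Sum>i<n. (x i + e i)\<^sup>2) = (\<Sum>i<n. (x i)\<^sup>2) + (\<Sum>i<n. (2 * x i) * e i) + (\<Sum>i<n. e i * e i)"
      by (simp add: power2_eq_square algebra_simps sum.distrib)
    also have "\<dots> = (\<Sum>i<n. (x i)\<^sup>2) + 2 * t * x k + t\<^sup>2"
      unfolding e1 by (simp add: e_def power2_eq_square)
    finally show ?thesis
      using le[of "\<lambda>i. x i + e i"] A eq by (simp add: b_def algebra_simps)
  qed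
  have "b = 0"
  proof (rule ccontr)
    assume "b \<noteq> 0"
    \<comment> \<open>\<open>c\<close> is positive and dominates the leading coefficient
      \<open>l - a k k\<close>; \<open>t = - b / c\<close> minimises
      \<open>2 * t * b + t^2 * c\<close>.\<close>
    define c where "c = \<bar>l - a k k\<bar> + 1"
    have "c > 0" by (simp add: c_def)
    have "0 \<le> 2 * (- b / c) * b + (- b / c)\<^sup>2 * (l - a k k)" by (rule pert)
    also have "\<dots> \<le> 2 * (- b / c) * b + (- b / c)\<^sup>2 * c"
      by (intro add_left_mono mult_left_mono) (auto simp: c_def)
    also have "\<dots> = - (b\<^sup>2 / c)"
      using \<open>c > 0\<close> by (simp add: field_simps power2_eq_square)
    also have "\<dots> < 0" using \<open>b \<noteq> 0\<close> \<open>c > 0\<close> by simp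
    finally show False by simp
  qed
  then show ?thesis by (simp add: b_def)
qed

lemma eigenvalue_iff_sum:
  fixes M :: "real mat"
  assumes "M \<in> carrier_mat n n"
  shows "eigenvalue M k \<longleftrightarrow>
    (\<exists>x. (\<exists>i<n. x i \<noteq> 0) \<and> (\<forall>i<n. (\<Sum>j<n. M $$ (i, j) * x j) = k * x i))"
proof
  assume "eigenvalue M k"
  then obtain v where v: "v \<in> carrier_vec n" "v \<noteq> 0\<^sub>v n" "M *\<^sub>v v = k \<cdot>\<^sub>v v"
    using assms by (auto simp: eigenvalue_def eigenvector_def)
  have "\<exists>i<n. v $ i \<noteq> 0"
  proof (rule ccontr)
    assume "\<not> (\<exists>i<n. v $ i \<noteq> 0)"
    then have "v = 0\<^sub>v n" using v(1) by (intro eq_vecI) auto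
    with v(2) show False by simp
  qed
  moreover have "(\<Sum>j<n. M $$ (i, j) * v $ j) = k * v $ i" if "i < n" for i
    using arg_cong[OF v(3), of "\<lambda>w. w $ i"] that v(1) assms
    by (simp add: scalar_prod_def atLeast0LessThan)
  ultimately show "\<exists>x. (\<exists>i<n. x i \<noteq> 0) \<and> (\<forall>i<n. (\<Sum>j<n. M $$ (i, j) * x j) = k * x i)"
    by blast
next
  assume "\<exists>x. (\<exists>i<n. x i \<noteq> 0) \<and> (\<forall>i<n. (\<Sum>j<n. M $$ (i, j) * x j) = k * x i)"
  then obtain x i where x: "i < n" "x i \<noteq> 0" "\<forall>i<n. (\<Sum>j<n. M $$ (i, j) * x j) = k * x i"
    by blast
  have "vec n x \<noteq> 0\<^sub>v n"
    using x(1,2) by (metis index_vec index_zero_vec(1))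
  moreover have "M *\<^sub>v vec n x = k \<cdot>\<^sub>v vec n x"
    using assms x(3) by (intro eq_vecI) (auto simp: scalar_prod_def atLeast0LessThan)
  ultimately show "eigenvalue M k"
    using assms by (auto simp: eigenvalue_def eigenvector_def intro!: exI[of _ "vec n x"])
qed

text \<open>The maximum \<open>l\<close> of the form on the unit sphere is an eigenvalue by the
  variational argument, and evaluating the form at any eigenvector bounds its eigenvalue by
  \<open>l\<close>. The finiteness that \<open>Max\<close> requires comes from the characteristic
  polynomial.\<close>

lemma lambda_max_rayleigh:
  fixes M :: "real mat"
  assumes M: "M \<in> carrier_mat n n" and "n > 0"
    and sym: "\<And>i j. i < n \<Longrightarrow> j < n \<Longrightarrow> M $$ (i, j) = M $$ (j, i)"
  shows lambda_max_attained: "\<exists>x. (\<Sum>i<n. (x i)\<^sup>2) = 1 \<and>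
          (\<Sum>i<n. \<Sum>j<n. M $$ (i, j) * x i * x j) = lambda_max M" (is ?A)
    and lambda_max_upper:
      "(\<Sum>i<n. \<Sum>j<n. M $$ (i, j) * y i * y j) \<le> lambda_max M * (\<Sum>i<n. (y i)\<^sup>2)" (is ?B)
proof -
  obtain x l where x: "(\<Sum>i<n. (x i)\<^sup>2) = 1" "(\<Sum>i<n. \<Sum>j<n. M $$ (i, j) * x i * x j) = l"
    "\<And>y. (\<Sum>i<n. \<Sum>j<n. M $$ (i, j) * y i * y j) \<le> l * (\<Sum>i<n. (y i)\<^sup>2)"
    by (rule rayleigh_maximum_exists[OF \<open>n > 0\<close>, of "\<lambda>i j. M $$ (i, j)"]) blast
  have "\<exists>i<n. x i \<noteq> 0"
  proof (rule ccontr)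
    assume "\<not> (\<exists>i<n. x i \<noteq> 0)"
    then have "(\<Sum>i<n. (x i)\<^sup>2) = 0" by simp
    with x(1) show False by simp
  qed
  moreover have "\<forall>i<n. (\<Sum>j<n. M $$ (i, j) * x j) = l * x i"
    using rayleigh_maximum_eigenvector[of n "\<lambda>i j. M $$ (i, j)" x l] sym x by auto
  ultimately have "eigenvalue M l"
    unfolding eigenvalue_iff_sum[OF M] by blast
  moreover have "k \<le> l" if "eigenvalue M k" for k
  proof -
    from that obtain z i where z: "i < n" "z i \<noteq> 0" "\<forall>i<n. (\<Sum>j<n. M $$ (i, j) * z j) = k * z i"
      unfolding eigenvalue_iff_sum[OF M] by blast
    have "(\<Sum>i<n. (z i)\<^sup>2) > 0"
      using z by (auto intro!: sum_pos2)
    have "(\<Sum>i<n. \<Sum>j<n. M $$ (i, j) * z i * z j) = (\<Sum>i<n. z i * (\<Sum>j<n. M $$ (i, j) * z j))"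
      by (simp add: sum_distrib_left mult_ac)
    also have "\<dots> = k * (\<Sum>i<n. (z i)\<^sup>2)"
      using z(3) by (simp add: sum_distrib_left power2_eq_square mult_ac)
    finally show ?thesis
      using x(3)[of z] \<open>(\<Sum>i<n. (z i)\<^sup>2) > 0\<close> by simp
  qed
  moreover have "finite {k. eigenvalue M k}"
  proof -
    have "char_poly M \<noteq> 0"
      using degree_monic_char_poly[OF M] by auto
    then show ?thesis
      unfolding eigenvalue_root_char_poly[OF M] by (rule poly_roots_finite)
  qed
  ultimately have "lambda_max M = l"
    unfolding lambda_max_def by (intro Max_eqI) auto
  with x show ?A ?B by auto
qed

subsection \<open>Rooted trees given by parent functions\<close>

text \<open>Any rank \<open>d\<close> that drops towards the root certifies the absence of cycles.
  Leaving \<open>d\<close> free makes new trees easy to certify; \<open>rooted_height\<close>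
  recovers the exact depth.\<close>

definition rooted :: "nat \<Rightarrow> nat \<Rightarrow> (nat \<Rightarrow> nat) \<Rightarrow> bool" where
  "rooted n r par \<longleftrightarrow>
     r < n \<and> (\<exists>d::nat \<Rightarrow> nat. \<forall>v<n. v \<noteq> r \<longrightarrow> par v < n \<and> d (par v) < d v)"

definition rtree :: "nat \<Rightarrow> nat \<Rightarrow> (nat \<Rightarrow> nat) \<Rightarrow> nat pair_pre_digraph" where
  "rtree n r par = \<lparr>pverts = {0..<n},
     parcs = (\<lambda>v. (v, par v)) ` ({..<n} - {r}) \<union> (\<lambda>v. (par v, v)) ` ({..<n} - {r})\<rparr>"

lemma rootedI:
  fixes d :: "nat \<Rightarrow> nat"
  assumes "r < n" "\<And>v. v < n \<Longrightarrow> v \<noteq> r \<Longrightarrow> par v < n \<and> d (par v) < d v"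
  shows "rooted n r par"
  using assms unfolding rooted_def by blast

lemma rooted_parent: "rooted n r par \<Longrightarrow> v < n \<Longrightarrow> v \<noteq> r \<Longrightarrow> par v < n"
  by (auto simp: rooted_def)

lemma rooted_root: "rooted n r par \<Longrightarrow> r < n"
  by (auto simp: rooted_def)

text \<open>The depth is the least number of parent steps that reach \<open>r\<close>. The
  two-colouring and the numbering of an unbranched tree rely on its changing by exactly 1 along an
  edge.\<close>

lemma rooted_height:
  assumes "rooted n r par"
  obtains h :: "nat \<Rightarrow> nat"
  where "h r = 0" "\<And>v. v < n \<Longrightarrow> v \<noteq> r \<Longrightarrow> h v = Suc (h (par v))"
proof -
  obtain d :: "nat \<Rightarrow> nat" where d: "\<forall>v<n. v \<noteq> r \<longrightarrow> par v < n \<and> d (par v) < d v"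
    using assms by (auto simp: rooted_def)
  have ex: "\<exists>k. (par ^^ k) v = r" if "v < n" for v
    using that
  proof (induction "d v" arbitrary: v rule: less_induct)
    case less
    show ?case
    proof (cases "v = r")
      case True
      then show ?thesis by (intro exI[of _ 0]) simp
    next
      case False
      then obtain k where "(par ^^ k) (par v) = r"
        using less d by blast
      then show ?thesis
        by (intro exI[of _ "Suc k"]) (simp add: funpow_swap1)
    qed
  qed
  define h where "h v = (LEAST k. (par ^^ k) v = r)" for v
  have "h v = Suc (h (par v))" if v: "v < n" "v \<noteq> r" for v
  proof -
    obtain k where "(par ^^ k) v = r" using ex v by blast
    then have "(LEAST k. (par ^^ k) v = r) = Suc (LEAST k. (par ^^ Suc k) v = r)"
      using v by (intro Least_Suc) auto
    then show ?thesis by (simp add: h_def funpow_swap1)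
  qed
  moreover have "h r = 0" by (auto simp: h_def)
  ultimately show ?thesis using that by blast
qed

lemma rtree_simps [simp]:
  "pverts (rtree n r par) = {0..<n}"
  "(a, b) \<in> parcs (rtree n r par) \<longleftrightarrow>
     a < n \<and> a \<noteq> r \<and> b = par a \<or> b < n \<and> b \<noteq> r \<and> a = par b"
  by (auto simp: rtree_def)

lemma parcs_rtree_subset:
  "rooted n r par \<Longrightarrow> parcs (rtree n r par) \<subseteq> {..<n} \<times> {..<n}"
  by (auto dest: rooted_parent)

lemma rtree_eqI:
  assumes "pverts T = {0..<n}"
    "\<And>a b. (a, b) \<in> parcs T \<longleftrightarrow> (a, b) \<in> parcs (rtree n r par)"
  shows "T = rtree n r par"
proof -
  have "parcs T = parcs (rtree n r par)"
    using assms(2) by (auto simp del: rtree_simps(2))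
  with assms(1) show ?thesis
    by (intro pair_pre_digraph.equality) auto
qed

lemma reroot_child:
  assumes "rooted n r par" "c < n" "c \<noteq> r" "par c = r"
  shows "rooted n c (par(r := c))" "rtree n c (par(r := c)) = rtree n r par"
proof -
  obtain h where h: "h r = 0" "\<And>v. v < n \<Longrightarrow> v \<noteq> r \<Longrightarrow> h v = Suc (h (par v))"
    using rooted_height[OF assms(1)] by metis
  show "rooted n c (par(r := c))"
    \<comment> \<open>Only the edge between \<open>r\<close> and \<open>c\<close> turns round: the
      new root gets rank 0 and every other vertex its old depth plus 1, which ranks even
      \<open>r\<close> above \<open>c\<close>.\<close>
    by (rule rootedI[where d = "\<lambda>v. if v = c then 0 else Suc (h v)"])
      (use assms h rooted_parent[OF assms(1)] in auto)
  show "rtree n c (par(r := c)) = rtree n r par"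
    using assms by (intro rtree_eqI) (auto simp: rooted_root)
qed

text \<open>Induction on the depth of \<open>w\<close>: once \<open>par w\<close> is the root,
  \<open>w\<close> is one of its children, and a single edge remains to be turned.\<close>

lemma reroot:
  assumes "rooted n r par" "w < n"
  obtains par' where "rooted n w par'" "rtree n w par' = rtree n r par"
proof -
  obtain h where h: "h r = 0" "\<And>v. v < n \<Longrightarrow> v \<noteq> r \<Longrightarrow> h v = Suc (h (par v))"
    using rooted_height[OF assms(1)] by metis
  have "\<exists>par'. rooted n w par' \<and> rtree n w par' = rtree n r par"
    using \<open>w < n\<close>
  proof (induction "h w" arbitrary: w rule: less_induct)
    case less
    show ?case
    proof (cases "w = r")
      case False
      then have "h (par w) < h w" "par w < n"
        using h less.prems rooted_parent[OF assms(1)] by auto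
      then obtain par' where par': "rooted n (par w) par'" "rtree n (par w) par' = rtree n r par"
        using less.hyps by blast
      have "(w, par w) \<in> parcs (rtree n (par w) par')"
        unfolding par' using less.prems False by simp
      then have "par' w = par w" by auto
      moreover have "w \<noteq> par w" using \<open>h (par w) < h w\<close> by auto
      ultimately show ?thesis
        using reroot_child[OF par'(1) \<open>w < n\<close>] par'(2) by auto
    qed (use assms in blast)
  qed
  then show ?thesis using that by blast
qed

text \<open>Depth decreases strictly along parent arcs, so no arc is both an upward and a downward
  one.\<close>

lemma sum_parcs_rtree:
  fixes f :: "nat \<times> nat \<Rightarrow> real"
  assumes "rooted n r par"
  shows "(\<Sum>e\<in>parcs (rtree n r par). f e) = (\<Sum>v\<in>{..<n} - {r}. f (v, par v) + f (par v, v))"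
proof -
  obtain h where h: "h r = 0" "\<And>v. v < n \<Longrightarrow> v \<noteq> r \<Longrightarrow> h v = Suc (h (par v))"
    using rooted_height[OF assms(1)] by metis
  have "h (par v) < h v" if "v \<in> {..<n} - {r}" for v
    using h(2)[of v] that by simp
  then have "(v, par v) \<noteq> (par w, w)" if "v \<in> {..<n} - {r}" "w \<in> {..<n} - {r}" for v w
    using that by (metis less_not_sym prod.inject)
  then have "(\<lambda>v. (v, par v)) ` ({..<n} - {r}) \<inter> (\<lambda>v. (par v, v)) ` ({..<n} - {r}) = {}"
    by blast
  then show ?thesis
    unfolding rtree_def by (simp add: sum.union_disjoint sum.reindex inj_on_def sum.distrib)
qed

subsection \<open>The quadratic form of the \<open>q\<close>-Laplacian\<close>

lemma sum_arcs:
  fixes f :: "nat \<times> nat \<Rightarrow> real"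
  assumes "E \<subseteq> {..<n} \<times> {..<n}"
  shows "(\<Sum>e\<in>E. f e) = (\<Sum>i<n. \<Sum>j<n. if (i, j) \<in> E then f (i, j) else 0)"
proof -
  have "(\<Sum>i<n. \<Sum>j<n. if (i, j) \<in> E then f (i, j) else 0)
      = (\<Sum>e\<in>{..<n} \<times> {..<n}. if e \<in> E then f e else 0)"
    by (auto simp: sum.cartesian_product intro!: sum.cong)
  also have "\<dots> = (\<Sum>e\<in>E. f e)"
    using assms by (simp add: sum.If_cases Int_absorb1)
  finally show ?thesis by simp
qed

lemma out_degree_eq_sum:
  fixes T :: "nat pair_pre_digraph"
  assumes "parcs T \<subseteq> {..<n} \<times> {..<n}"
  shows "real (out_degree T i) = (\<Sum>j<n. if (i, j) \<in> parcs T then 1 else 0)"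
proof -
  have "out_arcs T i = Pair i ` {j\<in>{..<n}. (i, j) \<in> parcs T}"
    using assms by (auto simp: out_arcs_def)
  then have "out_degree T i = card {j\<in>{..<n}. (i, j) \<in> parcs T}"
    by (simp add: out_degree_def card_image inj_on_def)
  then show ?thesis by (simp add: sum.If_cases Int_def)
qed

lemma q_laplacian_carrier: "q_laplacian n q T \<in> carrier_mat n n"
  by (simp add: q_laplacian_def degree_mat_def adjacency_mat_def mat_diag_def minus_mat_def)

lemma q_laplacian_index:
  assumes "i < n" "j < n"
  shows "q_laplacian n q T $$ (i, j) =
    (if i = j then 1 + q\<^sup>2 * (real (out_degree T i) - 1) else 0) -
    (if (i, j) \<in> parcs T then q else 0)"
  using assms by (simp add: q_laplacian_def degree_mat_def adjacency_mat_def mat_diag_def)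

lemma q_laplacian_form:
  assumes "parcs T \<subseteq> {..<n} \<times> {..<n}"
  shows "(\<Sum>i<n. \<Sum>j<n. q_laplacian n q T $$ (i, j) * x i * x j) =
    (\<Sum>i<n. (1 - q\<^sup>2) * (x i)\<^sup>2) + (\<Sum>(i, j)\<in>parcs T. q\<^sup>2 * (x i)\<^sup>2 - q * x i * x j)"
proof -
  let ?d = "\<lambda>i. real (out_degree T i)" and ?E = "parcs T"
  have "(\<Sum>j<n. q_laplacian n q T $$ (i, j) * x i * x j) =
      (1 - q\<^sup>2) * (x i)\<^sup>2 + (\<Sum>j<n. if (i, j) \<in> ?E then q\<^sup>2 * (x i)\<^sup>2 - q * x i * x j else 0)"
    if i: "i < n" for i
  proof -
    have "(\<Sum>j<n. q_laplacian n q T $$ (i, j) * x i * x j) =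
        (\<Sum>j<n. (if i = j then (1 + q\<^sup>2 * (?d i - 1)) * (x i)\<^sup>2 else 0) +
          (if (i, j) \<in> ?E then - (q * x i * x j) else 0))"
      using i by (intro sum.cong) (auto simp: q_laplacian_index power2_eq_square algebra_simps)
    also have "\<dots> = (1 - q\<^sup>2) * (x i)\<^sup>2 + ?d i * (q\<^sup>2 * (x i)\<^sup>2)
        + (\<Sum>j<n. if (i, j) \<in> ?E then - (q * x i * x j) else 0)"
      using i by (simp add: sum.distrib algebra_simps)
    also have "?d i * (q\<^sup>2 * (x i)\<^sup>2) = (\<Sum>j<n. if (i, j) \<in> ?E then q\<^sup>2 * (x i)\<^sup>2 else 0)"
      by (auto simp: out_degree_eq_sum[OF assms] sum_distrib_right intro!: sum.cong)
    finally show ?thesis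
      by (simp add: add.assoc sum.distrib[symmetric] if_distrib cong: if_cong)
  qed
  then show ?thesis
    by (simp add: sum_arcs[OF assms] sum.distrib cong: if_cong)
qed

definition edge_energy :: "real \<Rightarrow> real \<Rightarrow> real \<Rightarrow> real" where
  "edge_energy c a b = c\<^sup>2 * (a\<^sup>2 + b\<^sup>2) + 2 * c * a * b"

text \<open>
  The quadratic form with \<open>- q\<close> replaced by \<open>\<bar>q\<bar>\<close>. As trees are bipartite, flipping the signs on
  one colour class turns one form into the other.
\<close>
definition energy :: "nat \<Rightarrow> real \<Rightarrow> nat \<Rightarrow> (nat \<Rightarrow> nat) \<Rightarrow> (nat \<Rightarrow> real) \<Rightarrow> real" where
  "energy n c r par x =
     (\<Sum>v<n. (1 - c\<^sup>2) * (x v)\<^sup>2) + (\<Sum>v\<in>{..<n} - {r}. edge_energy c (x v) (x (par v)))"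

lemma edge_energy_commute: "edge_energy c a b = edge_energy c b a"
  by (simp add: edge_energy_def algebra_simps)

lemma edge_energy_mono:
  assumes "0 \<le> c" "0 \<le> a" "a \<le> a'" "0 \<le> b" "b \<le> b'"
  shows "edge_energy c a b \<le> edge_energy c a' b'"
proof -
  have "c * (a * b) \<le> c * (a' * b')"
    using assms by (intro mult_left_mono mult_mono) auto
  then show ?thesis
    unfolding edge_energy_def using assms
    by (intro add_mono mult_left_mono power_mono) (auto simp: algebra_simps)
qed

lemma q_laplacian_form_rtree:
  assumes "rooted n r par"
  shows "(\<Sum>i<n. \<Sum>j<n. q_laplacian n q (rtree n r par) $$ (i, j) * x i * x j) =
    (\<Sum>v<n. (1 - q\<^sup>2) * (x v)\<^sup>2) + (\<Sum>v\<in>{..<n} - {r}. edge_energy (- q) (x v) (x (par v)))"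
  unfolding q_laplacian_form[OF parcs_rtree_subset[OF assms]] sum_parcs_rtree[OF assms]
  by (simp add: edge_energy_def algebra_simps)

context
  fixes n r :: nat and par :: "nat \<Rightarrow> nat" and q :: real
  assumes rooted: "rooted n r par"
begin

lemma q_laplacian_rtree_sym:
  "i < n \<Longrightarrow> j < n \<Longrightarrow>
    q_laplacian n q (rtree n r par) $$ (i, j) = q_laplacian n q (rtree n r par) $$ (j, i)"
  by (auto simp: q_laplacian_index)

text \<open>Replacing a maximiser by its absolute values keeps the norm and can only raise each edge
  term.\<close>

lemma lambda_max_rtree_attained:
  "\<exists>x. (\<forall>i. 0 \<le> x i) \<and> (\<Sum>i<n. (x i)\<^sup>2) = 1 \<and>
     lambda_max (q_laplacian n q (rtree n r par)) \<le> energy n \<bar>q\<bar> r par x"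
proof -
  have "0 < n" using rooted_root[OF rooted] by simp
  then obtain x where x: "(\<Sum>i<n. (x i)\<^sup>2) = 1"
    "(\<Sum>i<n. \<Sum>j<n. q_laplacian n q (rtree n r par) $$ (i, j) * x i * x j) =
      lambda_max (q_laplacian n q (rtree n r par))"
    using lambda_max_attained[OF q_laplacian_carrier _ q_laplacian_rtree_sym] by blast
  have "edge_energy (- q) a b \<le> edge_energy \<bar>q\<bar> \<bar>a\<bar> \<bar>b\<bar>" for a b
  proof -
    have "- (q * a * b) \<le> \<bar>q\<bar> * \<bar>a\<bar> * \<bar>b\<bar>"
      by (metis abs_ge_minus_self abs_mult)
    then show ?thesis unfolding edge_energy_def by (simp only: power2_abs power2_minus)
  qed
  then have "lambda_max (q_laplacian n q (rtree n r par)) \<le> energy n \<bar>q\<bar> r par (\<lambda>v. \<bar>x v\<bar>)"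
    unfolding x(2)[symmetric] q_laplacian_form_rtree[OF rooted] energy_def
    by (auto intro!: sum_mono)
  with x(1) show ?thesis by (intro exI[of _ "\<lambda>v. \<bar>x v\<bar>"]) simp
qed

lemma energy_le_lambda_max:
  "energy n \<bar>q\<bar> r par x \<le> lambda_max (q_laplacian n q (rtree n r par)) * (\<Sum>i<n. (x i)\<^sup>2)"
proof -
  obtain h where h: "h r = 0" "\<And>v. v < n \<Longrightarrow> v \<noteq> r \<Longrightarrow> h v = Suc (h (par v))"
    using rooted_height[OF rooted] by metis
  \<comment> \<open>The depths of the ends of an edge differ by 1, so the sign turns
    \<open>- q\<close> into \<open>q\<close> in every mixed product; for \<open>q \<le> 0\<close>
    already \<open>- q = \<bar>q\<bar>\<close>.\<close>
  define y where "y v = (if q > 0 then (- 1) ^ h v * x v else x v)" for v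
  have y2: "(y v)\<^sup>2 = (x v)\<^sup>2" for v
    by (simp add: y_def power_mult_distrib flip: power_mult)
  have "edge_energy (- q) (y v) (y (par v)) = edge_energy \<bar>q\<bar> (x v) (x (par v))"
    if "v \<in> {..<n} - {r}" for v
    using h(2)[of v] that
    by (auto simp: edge_energy_def y2) (auto simp: y_def algebra_simps simp flip: power_add mult_2)
  then have "energy n \<bar>q\<bar> r par x =
    (\<Sum>i<n. \<Sum>j<n. q_laplacian n q (rtree n r par) $$ (i, j) * y i * y j)"
    unfolding q_laplacian_form_rtree[OF rooted] energy_def by (simp add: y2)
  also have "\<dots> \<le> lambda_max (q_laplacian n q (rtree n r par)) * (\<Sum>i<n. (y i)\<^sup>2)"
    using rooted_root[OF rooted]
    by (intro lambda_max_upper q_laplacian_carrier q_laplacian_rtree_sym) auto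
  finally show ?thesis by (simp add: y2)
qed

end

text \<open>Comparison principle: the maximiser for the first tree may be taken nonnegative, while
  any \<open>y\<close> of the same norm is an admissible test vector for the second.\<close>

lemma lambda_max_rtree_mono:
  assumes "rooted n r par" "rooted n r' par'"
    and "\<And>x. (\<And>i. 0 \<le> x i) \<Longrightarrow>
      \<exists>y. (\<Sum>i<n. (y i)\<^sup>2) = (\<Sum>i<n. (x i)\<^sup>2) \<and> energy n \<bar>q\<bar> r par x \<le> energy n \<bar>q\<bar> r' par' y"
  shows "lambda_max (q_laplacian n q (rtree n r par)) \<le> lambda_max (q_laplacian n q (rtree n r' par'))"
proof -
  obtain x where x: "\<And>i. 0 \<le> x i" "(\<Sum>i<n. (x i)\<^sup>2) = 1"
    "lambda_max (q_laplacian n q (rtree n r par)) \<le> energy n \<bar>q\<bar> r par x"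
    using lambda_max_rtree_attained[OF assms(1)] by blast
  have "\<exists>y. (\<Sum>i<n. (y i)\<^sup>2) = (\<Sum>i<n. (x i)\<^sup>2) \<and> energy n \<bar>q\<bar> r par x \<le> energy n \<bar>q\<bar> r' par' y"
    using x(1) by (rule assms(3))
  then obtain y where y: "(\<Sum>i<n. (y i)\<^sup>2) = 1" "energy n \<bar>q\<bar> r par x \<le> energy n \<bar>q\<bar> r' par' y"
    using x(2) by auto
  show ?thesis
    using x(3) y energy_le_lambda_max[OF assms(2), of q y] by simp
qed

subsection \<open>Generalized tree shifts\<close>

text \<open>The chain climbs from \<open>p 0\<close>, whose branches are moved, to the target
  \<open>p k\<close>; \<open>only_child\<close> encodes degree 2 inside. The target is the root when
  a generalized shift is analysed, but an arbitrary branching vertex in the reduction to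
  paths.\<close>

locale chain =
  fixes n r k :: nat and par p :: "nat \<Rightarrow> nat"
  assumes rooted: "rooted n r par"
    and length: "0 < k"
    and vertex: "\<And>i. i < k \<Longrightarrow> p i < n \<and> p i \<noteq> r"
    and step: "\<And>i. i < k \<Longrightarrow> par (p i) = p (Suc i)"
    and only_child: "\<And>i v. 0 < i \<Longrightarrow> i < k \<Longrightarrow> v < n \<Longrightarrow> v \<noteq> r \<Longrightarrow> par v = p i \<Longrightarrow> v = p (i - 1)"
begin

definition shifted :: "nat \<Rightarrow> nat" where
  "shifted v = (if par v = p 0 then p k else par v)"

lemma end_vertex: "p k < n"
  using rooted_parent[OF rooted, of "p (k - 1)"] vertex[of "k - 1"] step[of "k - 1"] length by simp

lemma height_decreasing:
  assumes "\<And>v. v < n \<Longrightarrow> v \<noteq> r \<Longrightarrow> h v = Suc (h (par v))" and "i < j" "j \<le> k"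
  shows "h (p j) < (h (p i) :: nat)"
  using assms(2,3)
proof (induction j)
  case (Suc j)
  have "h (p j) = Suc (h (p (Suc j)))"
    using assms(1)[of "p j"] vertex[of j] step[of j] Suc.prems by simp
  with Suc show ?case by (cases "i = j") auto
qed simp

lemma inj_on_chain: "inj_on p {..k}"
proof -
  obtain h where h: "h r = 0" "\<And>v. v < n \<Longrightarrow> v \<noteq> r \<Longrightarrow> h v = Suc (h (par v))"
    using rooted_height[OF rooted] by metis
  have "p i \<noteq> p j" if "i < j" "j \<le> k" for i j
    using height_decreasing[of h, OF h(2) that] by auto
  then show ?thesis
    by (intro linorder_inj_onI) auto
qed

lemma rooted_shifted: "rooted n r shifted"
proof -
  obtain h where h: "h r = 0" "\<And>v. v < n \<Longrightarrow> v \<noteq> r \<Longrightarrow> h v = Suc (h (par v))"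
    using rooted_height[OF rooted] by metis
  have "h (p k) < h (p 0)"
    using height_decreasing[of h, OF h(2), of 0 k] length by simp
  then have "shifted v < n \<and> h (shifted v) < h v" if "v < n" "v \<noteq> r" for v
    using that h(2)[of v] rooted_parent[OF rooted, of v] end_vertex
    by (auto simp: shifted_def)
  then show ?thesis
    using rooted_root[OF rooted] by (intro rootedI[where d = h]) auto
qed

text \<open>
  If the test vector is at least as large at the target \<open>p k\<close> of the shift as at \<open>p 0\<close>, then it can
  be kept. Otherwise its values along the chain are reversed: the chain itself contributes the same
  as before, and all branches at its two ends now see the larger end value.
\<close>
lemma energy_shifted:
  assumes x: "\<And>i. 0 \<le> x i" and c: "0 \<le> c"
  shows "\<exists>y. (\<Sum>i<n. (y i)\<^sup>2) = (\<Sum>i<n. (x i)\<^sup>2) \<and> energy n c r par x \<le> energy n c r shifted y"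
proof (cases "x (p 0) \<le> x (p k)")
  case True
  then have "x (par v) \<le> x (shifted v)" for v
    by (simp add: shifted_def)
  then have "energy n c r par x \<le> energy n c r shifted x"
    unfolding energy_def using x c by (intro add_left_mono sum_mono edge_energy_mono) auto
  then show ?thesis by blast
next
  case False
  let ?A = "{..<n} - {r}"
  \<comment> \<open>\<open>f\<close> is the involution that reverses the chain and fixes all other
    vertices, so \<open>y\<close> rearranges the values of \<open>x\<close>.\<close>
  define f where "f v = (if v \<in> p ` {..k} then p (k - the_inv_into {..k} p v) else v)" for v
  have f_chain: "f (p i) = p (k - i)" if "i \<le> k" for i
    using that by (simp add: f_def the_inv_into_f_f[OF inj_on_chain])
  have f_other: "f v = v" if "v \<notin> p ` {..k}" for v
    using that by (simp add: f_def)
  have p_less: "p i < n" if "i \<le> k" for i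
    using that vertex[of i] end_vertex by (cases "i = k") auto
  have ff: "f (f v) = v" and f_less: "v < n \<Longrightarrow> f v < n" for v
    using f_chain f_other p_less by (cases "v \<in> p ` {..k}"; auto)+
  define y where "y v = x (f v)" for v
  have "(\<Sum>i<n. (y i)\<^sup>2) = (\<Sum>i<n. (x i)\<^sup>2)"
    by (rule sum.reindex_bij_witness[where i = f and j = f]) (auto simp: ff f_less y_def)
  moreover have "(\<Sum>i<n. (1 - c\<^sup>2) * (y i)\<^sup>2) = (\<Sum>i<n. (1 - c\<^sup>2) * (x i)\<^sup>2)"
    by (rule sum.reindex_bij_witness[where i = f and j = f]) (auto simp: ff f_less y_def)
  moreover have "(\<Sum>v\<in>?A. edge_energy c (x v) (x (par v))) \<le> (\<Sum>v\<in>?A. edge_energy c (y v) (y (shifted v)))"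
  proof -
    let ?P = "p ` {..<k}"
    have inj: "inj_on p {..<k}" using inj_on_chain by (rule inj_on_subset) auto
    have "?P \<subseteq> ?A" using vertex by auto
    then have split: "(\<Sum>v\<in>?A. g v) = (\<Sum>i<k. g (p i)) + (\<Sum>v\<in>?A - ?P. g v)" for g :: "nat \<Rightarrow> real"
      by (simp add: sum.subset_diff[of ?P ?A] sum.reindex[OF inj])
    \<comment> \<open>Reversal maps the \<open>i\<close>-th chain edge to the one with index
      \<open>k - Suc i\<close>, so the chain as a whole keeps its energy.\<close>
    have "(\<Sum>i<k. edge_energy c (y (p i)) (y (shifted (p i)))) =
        (\<Sum>i<k. edge_energy c (x (p (Suc (k - Suc i)))) (x (p (k - Suc i))))"
    proof (rule sum.cong)
      fix i assume "i \<in> {..<k}"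
      then have i: "i < k" by simp
      have "p (Suc i) \<noteq> p 0"
        using inj_onD[OF inj_on_chain, of "Suc i" 0] i by auto
      then have "shifted (p i) = p (Suc i)"
        using step[OF i] by (simp add: shifted_def)
      then show "edge_energy c (y (p i)) (y (shifted (p i))) =
        edge_energy c (x (p (Suc (k - Suc i)))) (x (p (k - Suc i)))"
        using i f_chain[of i] f_chain[of "Suc i"] by (simp add: y_def Suc_diff_Suc)
    qed simp
    also have "\<dots> = (\<Sum>i<k. edge_energy c (x (p (Suc i))) (x (p i)))"
      by (rule sum.nat_diff_reindex)
    also have "\<dots> = (\<Sum>i<k. edge_energy c (x (p i)) (x (par (p i))))"
      by (intro sum.cong) (auto simp: step edge_energy_commute)
    finally have on_chain: "(\<Sum>i<k. edge_energy c (x (p i)) (x (par (p i)))) =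
      (\<Sum>i<k. edge_energy c (y (p i)) (y (shifted (p i))))" by simp
    have "edge_energy c (x v) (x (par v)) \<le> edge_energy c (y v) (y (shifted v))"
      if v: "v \<in> ?A - ?P" for v
    proof (intro edge_energy_mono c x)
      have y_end: "y (p k) = x (p 0)" using f_chain[of k] by (simp add: y_def)
      \<comment> \<open>Off \<open>?P\<close> only the value at \<open>p k\<close> changes, and
        there it rises from \<open>x (p k)\<close> to \<open>x (p 0)\<close>.\<close>
      have *: "x u \<le> y u" if "u \<notin> ?P" for u
      proof (cases "u = p k")
        case True
        then show ?thesis using y_end False by simp
      next
        case u: False
        then have "u \<notin> p ` {..k}" using that by (auto simp: le_less)
        then show ?thesis by (simp add: y_def f_other)
      qed
      from v show "x v \<le> y v" by (intro *) simp
      show "x (par v) \<le> y (shifted v)"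
      proof (cases "par v = p 0")
        case True
        then show ?thesis using y_end by (simp add: shifted_def)
      next
        case not0: False
        \<comment> \<open>Values at inner chain vertices may have dropped, but by
          \<open>only_child\<close> a child of such a vertex lies on the chain itself.\<close>
        have "par v \<notin> ?P"
        proof
          assume "par v \<in> ?P"
          then obtain i where i: "i < k" "par v = p i" by auto
          with not0 have "0 < i" by (cases i) auto
          then have "v = p (i - 1)" using only_child i v by auto
          with i v show False by auto
        qed
        with not0 show ?thesis by (simp add: shifted_def *)
      qed
    qed
    then show ?thesis
      unfolding split on_chain by (intro add_left_mono sum_mono) auto
  qed
  ultimately show ?thesis unfolding energy_def by (intro exI[of _ y]) simp
qed

lemma lambda_max_shifted:
  "lambda_max (q_laplacian n q (rtree n r par)) \<le> lambda_max (q_laplacian n q (rtree n r shifted))"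
  by (rule lambda_max_rtree_mono[OF rooted rooted_shifted]) (rule energy_shifted, auto)

end

section \<open>Generalized tree shifts as changes of the parent function\<close>

lemma rooted_acyclic:
  assumes "rooted n r par" "v < n" "v \<noteq> r"
  shows "par v \<noteq> v" "par v \<noteq> r \<Longrightarrow> par (par v) \<noteq> v"
proof -
  obtain h where h: "h r = 0" "\<And>v. v < n \<Longrightarrow> v \<noteq> r \<Longrightarrow> h v = Suc (h (par v))"
    using rooted_height[OF assms(1)] by metis
  show "par v \<noteq> v"
    using h(2)[of v] assms by auto
  show "par (par v) \<noteq> v" if "par v \<noteq> r"
    using h(2)[of v] h(2)[of "par v"] assms that rooted_parent[OF assms] by auto
qed

text \<open>Seen from the root \<open>u\<close>, the neighbour of \<open>w\<close> towards
  \<open>u\<close> is its parent, so the neighbours to be moved are precisely the children of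
  \<open>w\<close>.\<close>

lemma shift_edges_rtree:
  assumes "rooted n u par" "w < n" "w \<noteq> u"
  shows "shift_edges (rtree n u par) u w (par w) = rtree n u (\<lambda>v. if par v = w then u else par v)"
proof (rule rtree_eqI)
  define C where "C a b \<longleftrightarrow> a < n \<and> a \<noteq> u \<and> b = par a" for a b
  have arc: "(a, b) \<in> parcs (rtree n u par) \<longleftrightarrow> C a b \<or> C b a" for a b
    by (simp add: C_def)
  have arc': "(a, b) \<in> parcs (rtree n u (\<lambda>v. if par v = w then u else par v)) \<longleftrightarrow>
      C a b \<and> b \<noteq> w \<or> C a w \<and> b = u \<or> C b a \<and> a \<noteq> w \<or> C b w \<and> a = u" for a b
    by (auto simp: C_def)
  have acyclic: "\<not> (C w b \<and> C b w)" for b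
    using rooted_acyclic(2)[OF assms] by (auto simp: C_def)
  have parent: "C w b \<longleftrightarrow> b = par w" for b
    using assms(2,3) by (simp add: C_def)
  have Z: "{z. (w, z) \<in> parcs (rtree n u par) \<and> z \<noteq> par w} = {z. C z w}"
    unfolding arc using acyclic parent by blast
  show "pverts (shift_edges (rtree n u par) u w (par w)) = {0..<n}"
    by (simp add: shift_edges_def Let_def)
  have "(a, b) \<in> parcs (shift_edges (rtree n u par) u w (par w)) \<longleftrightarrow>
      (C a b \<or> C b a) \<and> \<not> (a = w \<and> C b w) \<and> \<not> (C a w \<and> b = w) \<or> a = u \<and> C b w \<or> C a w \<and> b = u"
    for a b
    unfolding shift_edges_def Z by (auto simp: arc Let_def simp del: rtree_simps(2))
  then show "(a, b) \<in> parcs (shift_edges (rtree n u par) u w (par w)) \<longleftrightarrow>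
      (a, b) \<in> parcs (rtree n u (\<lambda>v. if par v = w then u else par v))" for a b
    unfolding arc' using acyclic[of a] acyclic[of b] by blast
qed

lemma pcas_nth:
  assumes "pcas u p w" "j < length p"
  shows "p ! j = (pawalk_verts u p ! j, pawalk_verts u p ! Suc j)"
  using assms
proof (induction p arbitrary: j u)
  case (Cons e es)
  then show ?case by (cases j; cases es; cases e) auto
qed simp

lemma pawalk_verts_ends:
  assumes "pcas u p w"
  shows "pawalk_verts u p ! 0 = u" "pawalk_verts u p ! length p = w"
    "length (pawalk_verts u p) = Suc (length p)"
  using assms by (induction p arbitrary: u) auto

text \<open>From the root a path can only descend: a step upwards would return to the preceding
  vertex, which distinctness excludes.\<close>

lemma apath_from_root:
  fixes p :: "(nat \<times> nat) list"
  assumes rooted: "rooted n u par" and "pcas u p w" "set p \<subseteq> parcs (rtree n u par)"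
    and dist: "distinct (pawalk_verts u p)" and i: "i < length p"
  defines "vs \<equiv> pawalk_verts u p"
  shows "vs ! Suc i < n \<and> vs ! Suc i \<noteq> u \<and> par (vs ! Suc i) = vs ! i"
  using i
proof (induction i)
  case 0
  then have "(u, vs ! Suc 0) \<in> parcs (rtree n u par)"
    using assms pcas_nth[of u p w 0] pawalk_verts_ends[of u p w] by (metis nth_mem subsetD)
  then show ?case using pawalk_verts_ends[of u p w] assms by auto
next
  case (Suc i)
  have "(vs ! Suc i, vs ! Suc (Suc i)) \<in> parcs (rtree n u par)"
    using assms pcas_nth[of u p w "Suc i"] Suc.prems by (metis nth_mem subsetD)
  moreover have "vs ! Suc (Suc i) \<noteq> vs ! i"
    using dist Suc.prems pawalk_verts_ends[of u p w] assms by (simp add: nth_eq_iff_index_eq)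
  ultimately show ?case
    using Suc by auto
qed

lemma unique_child_if_degree_2:
  assumes "rooted n r par" "out_degree (rtree n r par) v = 2" "v < n" "v \<noteq> r"
    and child: "a < n" "a \<noteq> r" "par a = v" "b < n" "b \<noteq> r" "par b = v"
  shows "a = b"
proof (rule ccontr)
  assume "a \<noteq> b"
  have "par v \<noteq> a" "par v \<noteq> b"
    using rooted_acyclic(2)[OF assms(1)] assms by metis+
  have "finite (parcs (rtree n r par))"
    using parcs_rtree_subset[OF assms(1)] by (rule finite_subset) simp
  then have "finite (out_arcs (rtree n r par) v)"
    by (rule rev_finite_subset) (auto simp: out_arcs_def)
  moreover have "{(v, par v), (v, a), (v, b)} \<subseteq> out_arcs (rtree n r par) v"
    using assms by (auto simp: out_arcs_def)
  ultimately have "card {(v, par v), (v, a), (v, b)} \<le> 2"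
    using assms(2) by (metis card_mono out_degree_def)
  with \<open>a \<noteq> b\<close> \<open>par v \<noteq> a\<close> \<open>par v \<noteq> b\<close> show False by simp
qed

text \<open>After rerooting at \<open>u\<close> the path descends from \<open>u\<close> to
  \<open>w\<close>; read backwards it is a chain ending at the root, and the shift becomes
  \<open>shifted\<close>.\<close>

lemma gen_tree_shift_rtree:
  assumes rooted: "rooted n r par" and shift: "gen_tree_shift (rtree n r par) T"
  obtains r' par' where "rooted n r' par'" "T = rtree n r' par'"
    "\<And>q. lambda_max (q_laplacian n q (rtree n r par)) \<le> lambda_max (q_laplacian n q T)"
proof -
  obtain u w p where uw: "u \<noteq> w" and path: "pre_digraph.apath (rtree n r par) u p w"
    and deg: "\<forall>v \<in> set (pre_digraph.inner_verts (rtree n r par) p). out_degree (rtree n r par) v = 2"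
    and T: "T = shift_edges (rtree n r par) u w (fst (last p))"
    using shift unfolding gen_tree_shift_def by blast
  have p: "u < n" "pcas u p w" "set p \<subseteq> parcs (rtree n r par)" "distinct (pawalk_verts u p)"
    using path by (simp_all add: pre_digraph.apath_def pre_digraph.awalk_def cas_with_proj_eq
        awalk_verts_with_proj_eq)
  obtain par' where par': "rooted n u par'" "rtree n u par' = rtree n r par"
    using reroot[OF rooted p(1)] by metis
  define k where "k = length p"
  define vs where "vs = pawalk_verts u p"
  have "0 < k" using uw p(2) by (cases p) (auto simp: k_def)
  have ends: "vs ! 0 = u" "vs ! k = w" "length vs = Suc k"
    using pawalk_verts_ends[OF p(2)] by (simp_all add: vs_def k_def)
  have down: "vs ! Suc i < n" "vs ! Suc i \<noteq> u" "par' (vs ! Suc i) = vs ! i" if "i < k" for i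
    using apath_from_root[OF par'(1) p(2) _ p(4), of i] p(3) that
    unfolding par'(2) vs_def k_def by auto
  have deg2: "out_degree (rtree n u par') (vs ! i) = 2" if "0 < i" "i < k" for i
  proof -
    have "pre_digraph.inner_verts (rtree n r par) p = tl (map fst p)"
      by (simp add: pre_digraph.inner_verts_def)
    moreover have "vs ! i = tl (map fst p) ! (i - 1)"
      using that pcas_nth[OF p(2), of i] by (simp add: nth_tl k_def vs_def)
    ultimately have "vs ! i \<in> set (pre_digraph.inner_verts (rtree n r par) p)"
      using that by (simp add: k_def)
    then show ?thesis using deg unfolding par'(2) by blast
  qed
  interpret chain n u k par' "\<lambda>i. vs ! (k - i)"
  proof
    show "vs ! (k - i) < n \<and> vs ! (k - i) \<noteq> u" if "i < k" for i
      using down[of "k - Suc i"] that by (simp add: Suc_diff_Suc)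
    show "par' (vs ! (k - i)) = vs ! (k - Suc i)" if "i < k" for i
      using down[of "k - Suc i"] that by (simp add: Suc_diff_Suc)
    show "v = vs ! (k - (i - 1))" if "0 < i" "i < k" "v < n" "v \<noteq> u" "par' v = vs ! (k - i)" for i v
    proof (rule unique_child_if_degree_2[OF par'(1) deg2[of "k - i"]])
      show "vs ! (k - i) < n" "vs ! (k - i) \<noteq> u"
        using down[of "k - Suc i"] that by (simp_all add: Suc_diff_Suc)
      have "k - (i - 1) = Suc (k - i)" using that by simp
      then show "vs ! (k - (i - 1)) < n" "vs ! (k - (i - 1)) \<noteq> u"
        "par' (vs ! (k - (i - 1))) = vs ! (k - i)"
        using down[of "k - i"] that by simp_all
    qed (use that in auto)
  qed (use par' \<open>0 < k\<close> in auto)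
  have "fst (last p) = par' w"
  proof -
    have "last p = p ! (k - 1)" using \<open>0 < k\<close> by (simp add: k_def last_conv_nth)
    then have "fst (last p) = vs ! (k - 1)"
      using pcas_nth[OF p(2), of "k - 1"] \<open>0 < k\<close> by (simp add: k_def vs_def)
    then show ?thesis using down[of "k - 1"] \<open>0 < k\<close> ends by simp
  qed
  moreover have "w < n" using down[of "k - 1"] \<open>0 < k\<close> ends by simp
  moreover have "shifted = (\<lambda>v. if par' v = w then u else par' v)"
    by (simp add: fun_eq_iff shifted_def ends)
  ultimately have "T = rtree n u shifted"
    using shift_edges_rtree[OF par'(1), of w] uw unfolding T par'(2) by simp
  with rooted_shifted lambda_max_shifted show ?thesis
    unfolding par'(2) by (intro that) auto
qed

lemma gen_tree_shifts_rtree: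
  assumes "gen_tree_shift\<^sup>*\<^sup>* (rtree n r par) T" "rooted n r par"
  obtains r' par' where "rooted n r' par'" "T = rtree n r' par'"
    "\<And>q. lambda_max (q_laplacian n q (rtree n r par)) \<le> lambda_max (q_laplacian n q T)"
proof -
  have "\<exists>r' par'. rooted n r' par' \<and> T = rtree n r' par' \<and>
    (\<forall>q. lambda_max (q_laplacian n q (rtree n r par)) \<le> lambda_max (q_laplacian n q T))"
    using assms(1)
  proof (induction rule: rtranclp_induct)
    case base
    then show ?case using assms(2) by blast
  next
    case (step T T')
    then obtain r1 par1 where 1: "rooted n r1 par1" "T = rtree n r1 par1"
      "\<forall>q. lambda_max (q_laplacian n q (rtree n r par)) \<le> lambda_max (q_laplacian n q T)"
      by blast
    obtain r2 par2 where "rooted n r2 par2" "T' = rtree n r2 par2"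
      "\<And>q. lambda_max (q_laplacian n q (rtree n r1 par1)) \<le> lambda_max (q_laplacian n q T')"
      using gen_tree_shift_rtree[OF 1(1)] step.hyps(2) unfolding 1(2) by metis
    with 1 show ?case by (blast intro: order_trans)
  qed
  then show ?thesis using that by blast
qed

text \<open>A maximiser for \<open>T\<close>, relabelled along the isomorphism, is a test vector for
  \<open>T'\<close> of the same norm and the same value.\<close>

lemma lambda_max_iso_le:
  fixes T T' :: "nat pair_pre_digraph"
  assumes iso: "digraph_iso T T'" and "pair_wf_digraph T"
    and "pverts T = {0..<n}" "pverts T' = {0..<n}" "0 < n"
    and sym: "\<And>a b. (a, b) \<in> parcs T \<Longrightarrow> (b, a) \<in> parcs T"
  shows "lambda_max (q_laplacian n q T) \<le> lambda_max (q_laplacian n q T')"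
proof -
  obtain f where f: "bij_betw f {..<n} {..<n}" and T': "parcs T' = map_prod f f ` parcs T"
    using assms digraph_iso_pair_iff[of T T'] by (auto simp: atLeast0LessThan)
  have sub: "parcs T \<subseteq> {..<n} \<times> {..<n}"
    using pair_wf_digraph.in_arcsD1[OF assms(2)] pair_wf_digraph.in_arcsD2[OF assms(2)] assms(3)
    by (auto simp: atLeast0LessThan)
  then have sub': "parcs T' \<subseteq> {..<n} \<times> {..<n}"
    unfolding T' using f by (auto dest: bij_betwE)
  have sym': "(b, a) \<in> parcs T'" if "(a, b) \<in> parcs T'" for a b
    using that sym unfolding T' by force
  have mat: "q_laplacian n q G $$ (i, j) = q_laplacian n q G $$ (j, i)"
    if "i < n" "j < n" "\<And>a b. (a, b) \<in> parcs G \<Longrightarrow> (b, a) \<in> parcs G" for i j G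
    using that by (auto simp: q_laplacian_index)
  obtain x where x: "(\<Sum>i<n. (x i)\<^sup>2) = 1"
    "(\<Sum>i<n. \<Sum>j<n. q_laplacian n q T $$ (i, j) * x i * x j) = lambda_max (q_laplacian n q T)"
    using lambda_max_attained[OF q_laplacian_carrier \<open>0 < n\<close> mat[OF _ _ sym]] by blast
  define y where "y v = x (the_inv_into {..<n} f v)" for v
  have yf: "y (f v) = x v" if "v < n" for v
    using that f by (simp add: y_def the_inv_into_f_f bij_betw_def)
  have reindex: "(\<Sum>v<n. g (y v)) = (\<Sum>v<n. g (x v))" for g :: "real \<Rightarrow> real"
    by (simp add: sum.reindex_bij_betw[OF f, of "\<lambda>v. g (y v)", symmetric] yf)
  have "inj_on (map_prod f f) (parcs T)"
    using map_prod_inj_on[of f "{..<n}" f "{..<n}"] f sub inj_on_subset by (auto simp: bij_betw_def)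
  then have "(\<Sum>(i, j)\<in>parcs T'. q\<^sup>2 * (y i)\<^sup>2 - q * y i * y j) =
    (\<Sum>(i, j)\<in>parcs T. q\<^sup>2 * (x i)\<^sup>2 - q * x i * x j)"
    unfolding T' using sub by (subst sum.reindex) (auto simp: yf intro!: sum.cong)
  then have "lambda_max (q_laplacian n q T) =
    (\<Sum>i<n. \<Sum>j<n. q_laplacian n q T' $$ (i, j) * y i * y j)"
    using reindex[of "\<lambda>t. (1 - q\<^sup>2) * t\<^sup>2"] unfolding x(2)[symmetric] q_laplacian_form[OF sub]
      q_laplacian_form[OF sub'] by simp
  also have "\<dots> \<le> lambda_max (q_laplacian n q T') * (\<Sum>i<n. (y i)\<^sup>2)"
    by (rule lambda_max_upper[OF q_laplacian_carrier \<open>0 < n\<close> mat[OF _ _ sym']])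
  finally show ?thesis using x(1) reindex[of "\<lambda>t. t\<^sup>2"] by simp
qed

subsection \<open>Every tree is a rooted tree\<close>

lemma tree_on_facts:
  assumes "tree_on n T"
  shows "pverts T = {0..<n}" "0 < n" "pair_wf_digraph T"
    and "\<And>a b. (a, b) \<in> parcs T \<Longrightarrow> (b, a) \<in> parcs T"
    and "\<And>a b. (a, b) \<in> parcs T \<Longrightarrow> a < n \<and> b < n \<and> a \<noteq> b"
    and "\<And>a b. a < n \<Longrightarrow> b < n \<Longrightarrow> (a, b) \<in> (parcs T)\<^sup>*"
proof -
  interpret pair_graph T using assms by (simp add: tree_on_def)
  show V: "pverts T = {0..<n}" using assms by (simp add: tree_on_def)
  show "pair_wf_digraph T" by unfold_locales
  show sym: "(b, a) \<in> parcs T" if "(a, b) \<in> parcs T" for a b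
    using that by (rule arcs_symmetric)
  show "a < n \<and> b < n \<and> a \<noteq> b" if "(a, b) \<in> parcs T" for a b
    using that in_arcsD1[OF that] in_arcsD2[OF that] no_loops'[OF that] V by simp
  have con: "strongly_connected (mk_symmetric T)"
    using assms by (simp add: tree_on_def connected_def)
  then show "0 < n"
    by (auto simp: strongly_connected_def V)
  have "parcs (mk_symmetric T) \<subseteq> parcs T"
    using sym by (auto simp: parcs_mk_symmetric)
  moreover have "(a, b) \<in> (parcs (mk_symmetric T))\<^sup>*" if "a < n" "b < n" for a b
    using con that by (intro rtrancl_on_rtranclI[where F = "{0..<n}"]) (auto simp: strongly_connected_def V reachable_def)
  ultimately show "(a, b) \<in> (parcs T)\<^sup>*" if "a < n" "b < n" for a b
    using that rtrancl_mono by blast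
qed

lemma walk_of_sequence:
  assumes "j \<le> k"
  shows "pcas (P j) (map (\<lambda>i. (P i, P (Suc i))) [j..<k]) (P k)"
    and "pawalk_verts (P j) (map (\<lambda>i. (P i, P (Suc i))) [j..<k]) = map P [j..<Suc k]"
  using assms by (induction rule: inc_induct) (simp_all add: upt_conv_Cons)

text \<open>Breadth-first search: \<open>par v\<close> is the last vertex before \<open>v\<close> on
  a shortest walk from \<open>r\<close>, and the distance from \<open>r\<close> is the rank.\<close>

lemma spanning_rtree:
  assumes "r < n" and "\<And>v. v < n \<Longrightarrow> (r, v) \<in> R\<^sup>*" and "R \<subseteq> {..<n} \<times> {..<n}"
  obtains par where "rooted n r par" "\<And>v. v < n \<Longrightarrow> v \<noteq> r \<Longrightarrow> (par v, v) \<in> R"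
proof -
  define d where "d v = (LEAST k. (r, v) \<in> R ^^ k)" for v
  have "\<exists>u. (u, v) \<in> R \<and> u < n \<and> d u < d v" if v: "v < n" "v \<noteq> r" for v
  proof -
    have "\<exists>k. (r, v) \<in> R ^^ k"
      using assms(2)[OF v(1)] by (simp add: rtrancl_power)
    then have *: "(r, v) \<in> R ^^ d v"
      unfolding d_def by (rule LeastI_ex)
    then obtain k where k: "d v = Suc k"
      using v by (cases "d v") auto
    with * obtain u where u: "(r, u) \<in> R ^^ k" "(u, v) \<in> R" by auto
    have "d u \<le> k"
      unfolding d_def by (rule Least_le) (rule u)
    with u k assms(3) show ?thesis by auto
  qed
  then obtain par where par: "\<And>v. v < n \<Longrightarrow> v \<noteq> r \<Longrightarrow> (par v, v) \<in> R \<and> par v < n \<and> d (par v) < d v"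
    by metis
  then have "rooted n r par"
    using assms(1) by (intro rootedI[where d = d]) auto
  with par show ?thesis by (intro that) auto
qed

text \<open>A breadth-first spanning tree already contains all arcs: a further arc
  \<open>(a, b)\<close>, together with the climb from \<open>b\<close> to \<open>a\<close> in the
  spanning tree rerooted at \<open>a\<close>, would form a cycle.\<close>

lemma tree_on_rtree:
  assumes "tree_on n T"
  obtains r par where "rooted n r par" "T = rtree n r par"
proof -
  note tree = tree_on_facts[OF assms]
  have "parcs T \<subseteq> {..<n} \<times> {..<n}" using tree(5) by auto
  then obtain par where par: "rooted n 0 par" "\<And>v. v < n \<Longrightarrow> v \<noteq> 0 \<Longrightarrow> (par v, v) \<in> parcs T"
    using spanning_rtree[of 0 n "parcs T"] tree(2,6) by metis
  have sub: "(a, b) \<in> parcs T" if "(a, b) \<in> parcs (rtree n 0 par)" for a b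
    using that par(2) tree(4) by auto
  have "(a, b) \<in> parcs (rtree n 0 par)" if ab: "(a, b) \<in> parcs T" for a b
  proof (rule ccontr)
    assume not_arc: "(a, b) \<notin> parcs (rtree n 0 par)"
    have lt: "a < n" "b < n" "a \<noteq> b" using tree(5)[OF ab] by auto
    obtain par' where par': "rooted n a par'" "rtree n a par' = rtree n 0 par"
      using reroot[OF par(1) lt(1)] by metis
    obtain h where h: "h a = 0" "\<And>v. v < n \<Longrightarrow> v \<noteq> a \<Longrightarrow> h v = Suc (h (par' v))"
      using rooted_height[OF par'(1)] by metis
    define P where "P i = (par' ^^ i) b" for i
    define k where "k = h b"
    have P: "P i < n \<and> h (P i) = k - i" if "i \<le> k" for i
      using that
    proof (induction i)
      case (Suc i)
      then have "P i \<noteq> a" using h(1) by auto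
      with Suc h(2)[of "P i"] rooted_parent[OF par'(1), of "P i"] show ?case
        by (simp add: P_def)
    qed (simp add: P_def k_def lt)
    have inner: "P i \<noteq> a" if "i < k" for i
      using P[of i] h(1) that by auto
    have P_arc: "(P i, P (Suc i)) \<in> parcs T" if "i < k" for i
    proof (rule sub)
      show "(P i, P (Suc i)) \<in> parcs (rtree n 0 par)"
        unfolding par'(2)[symmetric] using inner[OF that] P[of i] that by (simp add: P_def)
    qed
    have "P k = a"
    proof (rule ccontr)
      assume "P k \<noteq> a"
      then show False using P[of k] h(2)[of "P k"] by simp
    qed
    \<comment> \<open>As \<open>(a, b)\<close> is no arc of the spanning tree, \<open>b\<close> has
      depth at least 2, so the cycle reaches the length 3 that \<open>tree_on\<close>
      forbids.\<close>
    have "par' b \<noteq> a"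
      using not_arc lt unfolding par'(2)[symmetric] by auto
    then have "2 \<le> k"
      using h(2)[of b] h(2)[of "par' b"] lt rooted_parent[OF par'(1), of b] by (simp add: k_def)
    have "inj_on P {0..<Suc k}"
    proof (rule inj_onI)
      fix i j assume "i \<in> {0..<Suc k}" "j \<in> {0..<Suc k}" "P i = P j"
      then show "i = j" using P[of i] P[of j] by auto
    qed
    define p where "p = (a, b) # map (\<lambda>i. (P i, P (Suc i))) [0..<k]"
    have "P 0 = b" by (simp add: P_def)
    have "pre_digraph.cycle T p"
      unfolding pre_digraph.cycle_def
    proof (intro exI conjI)
      show "pre_digraph.awalk T a p a"
        using walk_of_sequence(1)[of 0 k P] \<open>P 0 = b\<close> \<open>P k = a\<close> lt ab P_arc tree(1)
        by (auto simp: pre_digraph.awalk_def cas_with_proj_eq p_def)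
      show "distinct (tl (pre_digraph.awalk_verts T a p))"
        using walk_of_sequence(2)[of 0 k P] \<open>P 0 = b\<close> \<open>inj_on P {0..<Suc k}\<close>
        by (simp add: awalk_verts_with_proj_eq p_def distinct_map del: upt_Suc)
      show "p \<noteq> []" by (simp add: p_def)
    qed
    moreover have "3 \<le> length p" using \<open>2 \<le> k\<close> by (simp add: p_def)
    ultimately show False using assms by (auto simp: tree_on_def)
  qed
  with sub have "T = rtree n 0 par"
    using tree(1) by (intro rtree_eqI) blast+
  with par(1) show ?thesis by (rule that)
qed

subsection \<open>Paths\<close>

lemma path_tree_rtree: "path_tree n = rtree n 0 (\<lambda>v. v - 1)"
  by (rule rtree_eqI) (auto simp: path_tree_def)

lemma rooted_path: "0 < n \<Longrightarrow> rooted n 0 (\<lambda>v. v - 1)"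
  by (rule rootedI[where d = id]) auto

text \<open>Every number up to \<open>h v\<close> is the depth of \<open>v\<close> or of one of its
  ancestors, so there are at least \<open>h v + 1\<close> vertices.\<close>

lemma height_less:
  assumes "rooted n r par" "h r = 0" "\<And>v. v < n \<Longrightarrow> v \<noteq> r \<Longrightarrow> h v = Suc (h (par v))" "v < n"
  shows "h v < n"
proof -
  have "{..h v} \<subseteq> h ` {..<n}"
    using \<open>v < n\<close>
  proof (induction "h v" arbitrary: v rule: less_induct)
    case less
    show ?case
    proof (cases "v = r")
      case True
      then show ?thesis using assms(2) less.prems by auto
    next
      case False
      then have "h v = Suc (h (par v))" "par v < n"
        using assms(3) rooted_parent[OF assms(1)] less.prems by auto
      then have "{..h (par v)} \<subseteq> h ` {..<n}" using less.hyps by simp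
      moreover have "{..h v} = insert (h v) {..h (par v)}"
        by (simp only: \<open>h v = Suc (h (par v))\<close> atMost_Suc)
      ultimately show ?thesis using less.prems by auto
    qed
  qed
  then have "card {..h v} \<le> card (h ` {..<n})" by (intro card_mono) auto
  also have "\<dots> \<le> n" using card_image_le[of "{..<n}" h] by simp
  finally show ?thesis by simp
qed

text \<open>With at most one child per vertex each depth occurs once, so \<open>h\<close> numbers
  the vertices along a path starting at \<open>r\<close>, and composing with \<open>h\<close>
  carries test vectors over.\<close>

lemma lambda_max_path_le_unbranched:
  assumes rooted: "rooted n r par" and inj: "inj_on par ({..<n} - {r})"
  shows "lambda_max (q_laplacian n q (path_tree n)) \<le> lambda_max (q_laplacian n q (rtree n r par))"
proof -
  obtain h where h: "h r = 0" "\<And>v. v < n \<Longrightarrow> v \<noteq> r \<Longrightarrow> h v = Suc (h (par v))"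
    using rooted_height[OF rooted] by metis
  have less: "h v < n" if "v < n" for v
    using height_less[of n r par h, OF rooted h that] .
  have zero: "h v = 0 \<longleftrightarrow> v = r" if "v < n" for v
    using h(1) h(2)[OF that] by (cases "v = r") auto
  have "inj_on h {..<n}"
  proof (rule inj_onI)
    fix v w assume "v \<in> {..<n}" "w \<in> {..<n}" "h v = h w"
    then show "v = w"
    proof (induction "h v" arbitrary: v w rule: less_induct)
      case less
      show ?case
      proof (cases "v = r \<or> w = r")
        case True
        then show ?thesis using less.prems zero h(1) by auto
      next
        case False
        then have "par v = par w"
          using less h(2)[of v] h(2)[of w] rooted_parent[OF rooted] by simp
        then show ?thesis using inj less.prems False by (auto dest: inj_onD)
      qed
    qed
  qed
  moreover have "h ` {..<n} \<subseteq> {..<n}" using less by auto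
  ultimately have bij: "bij_betw h {..<n} {..<n}"
    by (simp add: bij_betw_def endo_inj_surj)
  have "bij_betw h ({..<n} - {r}) ({..<n} - {0})"
    using bij_betw_DiffI[OF bij, of "{r}" "{0}"] h(1) rooted_root[OF rooted] by simp
  then have edges: "(\<Sum>v\<in>{..<n} - {r}. g (h v)) = (\<Sum>i\<in>{..<n} - {0}. g i)" for g :: "nat \<Rightarrow> real"
    by (rule sum.reindex_bij_betw)
  show ?thesis
    unfolding path_tree_rtree
  proof (rule lambda_max_rtree_mono[OF rooted_path rooted])
    show "0 < n" using rooted_root[OF rooted] by simp
    fix x :: "nat \<Rightarrow> real"
    have "energy n \<bar>q\<bar> r par (\<lambda>v. x (h v)) = energy n \<bar>q\<bar> 0 (\<lambda>v. v - 1) x"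
    proof -
      have "(\<Sum>v\<in>{..<n} - {r}. edge_energy \<bar>q\<bar> (x (h v)) (x (h (par v)))) =
          (\<Sum>v\<in>{..<n} - {r}. edge_energy \<bar>q\<bar> (x (h v)) (x (h v - 1)))"
        by (intro sum.cong) (auto simp: h(2))
      then show ?thesis
        unfolding energy_def
        using sum.reindex_bij_betw[OF bij, of "\<lambda>i. (1 - \<bar>q\<bar>\<^sup>2) * (x i)\<^sup>2"]
          edges[of "\<lambda>i. edge_energy \<bar>q\<bar> (x i) (x (i - 1))"] by simp
    qed
    then show "\<exists>y. (\<Sum>i<n. (y i)\<^sup>2) = (\<Sum>i<n. (x i)\<^sup>2) \<and>
        energy n \<bar>q\<bar> 0 (\<lambda>v. v - 1) x \<le> energy n \<bar>q\<bar> r par y"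
      using sum.reindex_bij_betw[OF bij, of "\<lambda>i. (x i)\<^sup>2"]
      by (intro exI[of _ "\<lambda>v. x (h v)"]) simp
  qed
qed

section \<open>Removing branchings by inverse tree shifts\<close>

lemma rtree_cong:
  assumes "\<And>v. v < n \<Longrightarrow> v \<noteq> r \<Longrightarrow> par v = par' v"
  shows "rtree n r par = rtree n r par'"
  using assms by (intro rtree_eqI) auto

text \<open>
  Let \<open>u\<close> be a branching vertex of maximal height, with children \<open>a \<noteq> b\<close>. Below \<open>a\<close> the tree is a
  path ending in some leaf \<open>w\<close>; moving \<open>b\<close> from \<open>u\<close> to \<open>w\<close> is the inverse of a generalized tree
  shift and destroys the leaf \<open>w\<close>.
\<close>
lemma unbranching_step:
  assumes rooted: "rooted n r par" and branched: "\<not> inj_on par ({..<n} - {r})"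
  obtains par' where "rooted n r par'"
    "\<And>q. lambda_max (q_laplacian n q (rtree n r par')) \<le> lambda_max (q_laplacian n q (rtree n r par))"
    "{..<n} - par' ` ({..<n} - {r}) \<subset> {..<n} - par ` ({..<n} - {r})"
proof -
  let ?A = "{..<n} - {r}"
  obtain h where h: "h r = 0" "\<And>v. v < n \<Longrightarrow> v \<noteq> r \<Longrightarrow> h v = Suc (h (par v))"
    using rooted_height[OF rooted] by metis
  note less = height_less[of n r par h, OF rooted h]
  define B where "B u \<longleftrightarrow> (\<exists>a\<in>?A. \<exists>b\<in>?A. a \<noteq> b \<and> par a = u \<and> par b = u)" for u
  have "\<exists>u. B u" using branched by (auto simp: inj_on_def B_def)
  moreover have "\<forall>u. B u \<longrightarrow> h u < n"
    using less rooted_parent[OF rooted] by (auto simp: B_def)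
  ultimately obtain u where u: "B u" "\<And>v. B v \<Longrightarrow> h v \<le> h u"
    using ex_has_greatest_nat[of B _ h n] by metis
  then obtain a b where ab: "a \<in> ?A" "b \<in> ?A" "a \<noteq> b" "par a = u" "par b = u"
    unfolding B_def by blast
  \<comment> \<open>\<open>(x, a) \<in> R\<^sup>*\<close> says that \<open>x\<close> lies in the
    subtree of \<open>a\<close>; the leaf \<open>w\<close> will be a deepest vertex there.\<close>
  define R where "R = {(v, par v) | v. v \<in> ?A}"
  have below: "h x > h y" if "(x, y) \<in> R\<^sup>*" "x \<noteq> y" for x y
    using that
  proof (induction rule: converse_rtrancl_induct)
    case (step x z)
    then have "h x = Suc (h z)" using h(2) by (auto simp: R_def)
    with step show ?case by (cases "z = y") auto
  qed simp
  have in_A: "x \<in> ?A" if "(x, a) \<in> R\<^sup>*" for x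
    using that ab(1) by (cases rule: converse_rtranclE) (auto simp: R_def)
  have "\<forall>v. (v, a) \<in> R\<^sup>* \<longrightarrow> h v < n" using in_A less by auto
  then obtain w where w: "(w, a) \<in> R\<^sup>*" "\<And>v. (v, a) \<in> R\<^sup>* \<Longrightarrow> h v \<le> h w"
    using ex_has_greatest_nat[of "\<lambda>v. (v, a) \<in> R\<^sup>*" a h n] by blast
  have leaf: "par v \<noteq> w" if "v \<in> ?A" for v
  proof
    assume "par v = w"
    then have "(v, w) \<in> R" using that by (auto simp: R_def)
    then have "(v, a) \<in> R\<^sup>*" using w(1) by (rule converse_rtrancl_into_rtrancl)
    then show False using w(2) h(2)[of v] that \<open>par v = w\<close> by fastforce
  qed
  \<comment> \<open>The ancestors of \<open>w\<close> are linearly ordered, while \<open>a\<close>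
    and \<open>b\<close> are distinct and equally deep. Hence hanging \<open>b\<close> below
    \<open>w\<close> creates no cycle.\<close>
  have "(w, b) \<notin> R\<^sup>*"
  proof
    assume "(w, b) \<in> R\<^sup>*"
    moreover have "single_valued R" by (auto simp: single_valued_def R_def)
    ultimately have "(a, b) \<in> R\<^sup>* \<or> (b, a) \<in> R\<^sup>*"
      using w(1) single_valued_confluent by metis
    moreover have "h a = h b" using h(2) ab by simp
    ultimately show False using below ab(3) by fastforce
  qed
  define par' where "par' = par(b := w)"
  \<comment> \<open>Adding \<open>n\<close> lifts the ranks in the subtree of \<open>b\<close> above
    that of \<open>w\<close>, since all depths are below \<open>n\<close>.\<close>
  define d where "d v = h v + (if (v, b) \<in> R\<^sup>* then n else 0)" for v
  have "w \<in> ?A" using in_A w(1) by blast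
  have "rooted n r par'"
  proof (rule rootedI[where d = d])
    show "r < n" using rooted by (rule rooted_root)
    fix v assume v: "v < n" "v \<noteq> r"
    show "par' v < n \<and> d (par' v) < d v"
    proof (cases "v = b")
      case True
      then show ?thesis
        using \<open>w \<in> ?A\<close> \<open>(w, b) \<notin> R\<^sup>*\<close> less[of w] by (simp add: par'_def d_def)
    next
      case False
      have "(v, par v) \<in> R" using v by (auto simp: R_def)
      then have "(par v, b) \<in> R\<^sup>* \<Longrightarrow> (v, b) \<in> R\<^sup>*" by (rule converse_rtrancl_into_rtrancl)
      then show ?thesis
        using False v h(2)[of v] rooted_parent[OF rooted] by (auto simp: par'_def d_def)
    qed
  qed
  obtain l where "(w, a) \<in> R ^^ l" using w(1) by (auto simp: rtrancl_power)
  then obtain f where f: "f 0 = w" "f l = a" "\<And>i. i < l \<Longrightarrow> (f i, f (Suc i)) \<in> R"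
    unfolding relpow_fun_conv by blast
  have fa: "(f i, a) \<in> R\<^sup>*" if "i \<le> l" for i
    using that
  proof (induction rule: inc_induct)
    case (step i)
    then show ?case using f(3) by (meson converse_rtrancl_into_rtrancl)
  qed (simp add: f)
  have f_up: "par (f i) = f (Suc i)" if "i < l" for i
    using f(3)[OF that] by (auto simp: R_def)
  have ha: "h a = Suc (h u)" using h(2) ab by simp
  have fu: "h u < h (f i)" if "i \<le> l" for i
    using below[OF fa[OF that]] ha by (cases "f i = a") auto
  have "f i \<noteq> b" if "i \<le> l" for i
  proof
    assume "f i = b"
    then have "(b, a) \<in> R\<^sup>*" using fa[OF that] by simp
    then show False using below[of b a] ab(3,5) ha h(2)[of b] ab(2) by simp
  qed
  \<comment> \<open>\<open>f\<close> climbs from \<open>w\<close> to \<open>a\<close> in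
    \<open>l\<close> steps; the last step from \<open>a\<close> to \<open>u\<close> gives the chain
    length \<open>Suc l\<close>.\<close>
  define p where "p i = (if i \<le> l then f i else u)" for i
  interpret chain n r "Suc l" par' p
  proof
    show "rooted n r par'" by fact
    show "p i < n \<and> p i \<noteq> r" if "i < Suc l" for i
      using in_A[OF fa[of i]] that by (simp add: p_def)
    show "par' (p i) = p (Suc i)" if "i < Suc l" for i
      using that f_up[of i] f(2) ab(4) \<open>\<And>i. i \<le> l \<Longrightarrow> f i \<noteq> b\<close>[of i]
      by (cases "i = l") (auto simp: p_def par'_def)
    show "v = p (i - 1)" if i: "0 < i" "i < Suc l" and v: "v < n" "v \<noteq> r" "par' v = p i" for i v
    proof -
      have prev: "par (f (i - 1)) = f i" "f (i - 1) \<in> ?A"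
        using f_up[of "i - 1"] in_A[OF fa[of "i - 1"]] i by auto
      have "f i \<noteq> w" using leaf prev by metis
      then have "v \<noteq> b" using v(3) i by (auto simp: par'_def p_def)
      then have "par v = f i" using v(3) i by (simp add: par'_def p_def)
      \<comment> \<open>\<open>f i\<close> is deeper than \<open>u\<close>, which is a deepest
        branching vertex.\<close>
      moreover have "\<not> B (f i)" using u(2) fu[of i] i by fastforce
      ultimately have "v = f (i - 1)" using prev v unfolding B_def by blast
      moreover have "i - 1 \<le> l" using i by simp
      ultimately show ?thesis by (simp only: p_def if_True)
    qed
  qed simp
  \<comment> \<open>The only child of \<open>w\<close> under \<open>par'\<close> is
    \<open>b\<close>, so the shift restores the original tree.\<close>
  have "rtree n r shifted = rtree n r par"
    unfolding shifted_def by (rule rtree_cong) (use leaf f(1) ab in \<open>auto simp: par'_def p_def\<close>)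
  then have "lambda_max (q_laplacian n q (rtree n r par')) \<le> lambda_max (q_laplacian n q (rtree n r par))" for q
    using lambda_max_shifted by metis
  \<comment> \<open>These are the sets of childless vertices: \<open>w\<close> drops out, and
    \<open>u\<close> does not enter because it keeps the child \<open>a\<close>.\<close>
  moreover have "{..<n} - par' ` ?A \<subset> {..<n} - par ` ?A"
  proof -
    have "par v \<in> par' ` ?A" if "v \<in> ?A" for v
    proof (cases "v = b")
      case True
      then have "par v = par' a" using ab by (simp add: par'_def)
      then show ?thesis using ab(1) by blast
    next
      case False
      then have "par v = par' v" by (simp add: par'_def)
      then show ?thesis using that by blast
    qed
    moreover have "w \<in> par' ` ?A" using ab(2) by (intro image_eqI[of _ _ b]) (auto simp: par'_def)
    moreover have "w \<notin> par ` ?A" "w \<in> {..<n}" using leaf \<open>w \<in> ?A\<close> by auto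
    ultimately show ?thesis by blast
  qed
  ultimately show ?thesis using \<open>rooted n r par'\<close> by (intro that)
qed

lemma lambda_max_path_le:
  "rooted n r par \<Longrightarrow>
    lambda_max (q_laplacian n q (path_tree n)) \<le> lambda_max (q_laplacian n q (rtree n r par))"
proof (induction "card ({..<n} - par ` ({..<n} - {r}))" arbitrary: par rule: less_induct)
  case less
  show ?case
  proof (cases "inj_on par ({..<n} - {r})")
    case True
    then show ?thesis using lambda_max_path_le_unbranched less.prems by blast
  next
    case False
    then obtain par' where par': "rooted n r par'"
      "lambda_max (q_laplacian n q (rtree n r par')) \<le> lambda_max (q_laplacian n q (rtree n r par))"
      "{..<n} - par' ` ({..<n} - {r}) \<subset> {..<n} - par ` ({..<n} - {r})"
      using unbranching_step[OF less.prems] by metis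
    then have "card ({..<n} - par' ` ({..<n} - {r})) < card ({..<n} - par ` ({..<n} - {r}))"
      by (intro psubset_card_mono) auto
    then show ?thesis using less.hyps par' by fastforce
  qed
qed

subsection \<open>Stars\<close>

lemma star_tree_rtree: "star_tree n = rtree n 0 (\<lambda>_. 0)" if "0 < n"
  using that by (intro rtree_eqI) (auto simp: star_tree_def)

lemma rooted_star: "0 < n \<Longrightarrow> rooted n 0 (\<lambda>_. 0)"
  by (rule rootedI[where d = "\<lambda>v. v"]) auto

section \<open>Degrees and their sums over neighbourhoods\<close>

definition neighbours :: "nat \<Rightarrow> nat \<Rightarrow> (nat \<Rightarrow> nat) \<Rightarrow> nat \<Rightarrow> nat set" where
  "neighbours n r par i = {j \<in> {..<n}. (i, j) \<in> parcs (rtree n r par)}"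

lemma neighbours_nonempty:
  assumes "rooted n r par" "2 \<le> n" "i < n"
  shows "1 \<le> card (neighbours n r par i)"
proof -
  obtain w where w: "w < n" "w \<noteq> i"
    using assms(2) that[of "if i = 0 then 1 else 0"] by (simp split: if_splits)
  obtain par' where par': "rooted n w par'" "rtree n w par' = rtree n r par"
    using reroot[OF assms(1) w(1)] by metis
  have "par' i \<in> neighbours n r par i"
    unfolding neighbours_def par'(2)[symmetric]
    using rooted_parent[OF par'(1)] assms(3) w by auto
  then have "neighbours n r par i \<noteq> {}" "finite (neighbours n r par i)"
    by (auto simp: neighbours_def)
  then show ?thesis by (simp add: Suc_leI card_gt_0_iff)
qed

text \<open>A child of the root has at most one neighbour more than it has children, so the sum is
  at most the number of children and grandchildren of \<open>i\<close>, which are distinct vertices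
  other than \<open>i\<close>.\<close>

lemma sum_degrees_neighbours_root:
  assumes rooted: "rooted n i par"
  shows "(\<Sum>j\<in>neighbours n i par i. card (neighbours n i par j)) \<le> n - 1"
proof -
  let ?A = "{..<n} - {i}"
  define C where "C j = {v \<in> ?A. par v = j}" for j
  have fin: "finite (C j)" for j by (simp add: C_def)
  have Ni: "neighbours n i par i = C i"
    by (auto simp: neighbours_def C_def)
  have "card (neighbours n i par j) \<le> card (C j) + 1" for j
  proof -
    have "neighbours n i par j \<subseteq> insert (par j) (C j)"
      by (auto simp: neighbours_def C_def)
    then have "card (neighbours n i par j) \<le> card (insert (par j) (C j))"
      by (intro card_mono) (auto simp: fin)
    also have "\<dots> \<le> card (C j) + 1" by (simp add: card_insert_if fin)
    finally show ?thesis .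
  qed
  then have "(\<Sum>j\<in>C i. card (neighbours n i par j)) \<le> (\<Sum>j\<in>C i. card (C j) + 1)"
    by (rule sum_mono)
  also have "\<dots> = (\<Sum>j\<in>C i. card (C j)) + card (C i)"
    by (simp only: sum.distrib) simp
  also have "(\<Sum>j\<in>C i. card (C j)) = card (\<Union>j\<in>C i. C j)"
    by (subst card_UN_disjoint) (auto simp: C_def)
  also have "\<dots> + card (C i) = card ((\<Union>j\<in>C i. C j) \<union> C i)"
    by (subst card_Un_disjoint) (auto simp: C_def)
  also have "\<dots> \<le> card ?A"
    by (intro card_mono) (auto simp: C_def)
  also have "\<dots> = n - 1"
    using rooted_root[OF rooted] by simp
  finally show ?thesis by (simp add: Ni)
qed

lemma sum_degrees_neighbours:
  assumes "rooted n r par" "i < n"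
  shows "(\<Sum>j\<in>neighbours n r par i. card (neighbours n r par j)) \<le> n - 1"
proof -
  obtain par' where par': "rooted n i par'" "rtree n i par' = rtree n r par"
    using reroot[OF assms] by metis
  have "neighbours n r par = neighbours n i par'"
    by (simp add: neighbours_def fun_eq_iff par'(2))
  then show ?thesis using sum_degrees_neighbours_root[OF par'(1)] by simp
qed

text \<open>The arithmetic-geometric inequality weighted by \<open>y\<close> splits each mixed term
  between the two ends of its edge; the shares collected at \<open>i\<close> are the
  \<open>i\<close>-th row applied to \<open>y\<close>, divided by \<open>y i\<close>. The identity
  part of the matrix is left out of \<open>super\<close>, hence \<open>1 + m\<close>.\<close>

lemma energy_le_if_supersolution:
  assumes rooted: "rooted n r par" and c: "0 \<le> c"
    and pos: "\<And>i. i < n \<Longrightarrow> 0 < y i"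
    and super: "\<And>i. i < n \<Longrightarrow>
      c\<^sup>2 * (real (card (neighbours n r par i)) - 1) * y i + c * (\<Sum>j\<in>neighbours n r par i. y j) \<le> m * y i"
  shows "energy n c r par x \<le> (1 + m) * (\<Sum>i<n. (x i)\<^sup>2)"
proof -
  let ?N = "neighbours n r par"
  define g where "g = (\<lambda>(i, j). (x i)\<^sup>2 * (c\<^sup>2 + c * (y j / y i)))"
  have "edge_energy c (x v) (x (par v)) \<le> g (v, par v) + g (par v, v)" if v: "v \<in> {..<n} - {r}" for v
  proof -
    have y: "0 < y v" "0 < y (par v)" using pos rooted_parent[OF rooted] v by auto
    define a b where "a = y (par v) * x v" and "b = y v * x (par v)"
    have "2 * (a * b) \<le> a\<^sup>2 + b\<^sup>2" using sum_squares_bound[of a b] by simp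
    then have "2 * (a * b) / (y v * y (par v)) \<le> (a\<^sup>2 + b\<^sup>2) / (y v * y (par v))"
      using y by (intro divide_right_mono) auto
    then have "2 * (x v * x (par v)) \<le> (x v)\<^sup>2 * (y (par v) / y v) + (x (par v))\<^sup>2 * (y v / y (par v))"
      using y by (simp add: a_def b_def power2_eq_square add_divide_distrib mult_ac)
    then have "c * (2 * (x v * x (par v))) \<le>
        c * ((x v)\<^sup>2 * (y (par v) / y v) + (x (par v))\<^sup>2 * (y v / y (par v)))"
      using c by (rule mult_left_mono)
    then show ?thesis
      by (simp add: edge_energy_def g_def algebra_simps)
  qed
  then have "(\<Sum>v\<in>{..<n} - {r}. edge_energy c (x v) (x (par v))) \<le> (\<Sum>e\<in>parcs (rtree n r par). g e)"
    unfolding sum_parcs_rtree[OF rooted] by (rule sum_mono)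
  also have "\<dots> = (\<Sum>i<n. \<Sum>j\<in>?N i. g (i, j))"
    unfolding sum_arcs[OF parcs_rtree_subset[OF rooted]] neighbours_def
    by (intro sum.cong refl sum.inter_filter[symmetric]) simp
  also have "\<dots> \<le> (\<Sum>i<n. (c\<^sup>2 + m) * (x i)\<^sup>2)"
  proof (rule sum_mono)
    fix i assume "i \<in> {..<n}"
    then have i: "i < n" by simp
    have "(\<Sum>j\<in>?N i. g (i, j)) = (x i)\<^sup>2 * (c\<^sup>2 * card (?N i) + c * (\<Sum>j\<in>?N i. y j) / y i)"
      by (simp add: g_def sum_distrib_left[symmetric] sum.distrib sum_divide_distrib[symmetric] mult_ac)
    moreover have "c\<^sup>2 * card (?N i) + c * (\<Sum>j\<in>?N i. y j) / y i \<le> c\<^sup>2 + m"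
      using super[OF i] pos[OF i] by (simp add: field_simps)
    ultimately show "(\<Sum>j\<in>?N i. g (i, j)) \<le> (c\<^sup>2 + m) * (x i)\<^sup>2"
      by (simp only: mult.commute[of _ "(x i)\<^sup>2"] mult_left_mono zero_le_power2)
  qed
  finally show ?thesis
    unfolding energy_def sum_distrib_left[symmetric] by (simp add: algebra_simps)
qed

text \<open>In the sign-free form the star has the eigenvector \<open>m\<close> at the centre and
  \<open>c\<close> at the leaves, for the eigenvalue \<open>1 + m\<close>: the equation at a leaf
  holds for every \<open>m\<close>, and the one at the centre is the assumption on
  \<open>m\<close>.\<close>

lemma lambda_max_star_lower:
  fixes c m :: real
  assumes "2 \<le> n" and c: "0 < c" "c = \<bar>q\<bar>" and m: "m\<^sup>2 = c\<^sup>2 * (real n - 2) * m + c\<^sup>2 * (real n - 1)"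
  shows "1 + m \<le> lambda_max (q_laplacian n q (star_tree n))"
proof -
  have "0 < n" using assms(1) by simp
  define x where "x v = (if v = 0 then m else c)" for v :: nat
  have split: "(\<Sum>v<n. f v) = f 0 + (\<Sum>v\<in>{..<n} - {0}. f v)" for f :: "nat \<Rightarrow> real"
    using \<open>0 < n\<close> by (simp add: sum.remove)
  have N: "real (card ({..<n} - {0})) = real n - 1" using \<open>0 < n\<close> by simp
  have x2: "(\<Sum>v<n. (x v)\<^sup>2) = m\<^sup>2 + (real n - 1) * c\<^sup>2"
    unfolding split using N by (simp add: x_def)
  have "(\<Sum>v\<in>{..<n} - {0}. edge_energy c (x v) (x 0)) = (real n - 1) * (c\<^sup>2 * (c\<^sup>2 + m\<^sup>2) + 2 * c * c * m)"
    using N by (simp add: x_def edge_energy_def)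
  then have "energy n c 0 (\<lambda>_. 0) x =
      (1 - c\<^sup>2) * (\<Sum>v<n. (x v)\<^sup>2) + (real n - 1) * (c\<^sup>2 * (c\<^sup>2 + m\<^sup>2) + 2 * c * c * m)"
    by (simp add: energy_def sum_distrib_left)
  also have "\<dots> = (1 + m) * (\<Sum>v<n. (x v)\<^sup>2)"
  proof -
    have "(real n - 1) * (c\<^sup>2 * (c\<^sup>2 + m\<^sup>2) + 2 * c * c * m) - (c\<^sup>2 + m) * (m\<^sup>2 + (real n - 1) * c\<^sup>2)
      = m * (c\<^sup>2 * (real n - 2) * m + c\<^sup>2 * (real n - 1) - m\<^sup>2)"
      by (simp add: power2_eq_square algebra_simps)
    also have "\<dots> = 0" using m by simp
    finally have "(real n - 1) * (c\<^sup>2 * (c\<^sup>2 + m\<^sup>2) + 2 * c * c * m) = (c\<^sup>2 + m) * (\<Sum>v<n. (x v)\<^sup>2)"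
      unfolding x2 by simp
    then show ?thesis by (simp only: distrib_right left_diff_distrib)
  qed
  finally have "energy n c 0 (\<lambda>_. 0) x = (1 + m) * (\<Sum>v<n. (x v)\<^sup>2)" .
  moreover have "energy n c 0 (\<lambda>_. 0) x \<le> lambda_max (q_laplacian n q (star_tree n)) * (\<Sum>v<n. (x v)\<^sup>2)"
    unfolding star_tree_rtree[OF \<open>0 < n\<close>] c(2)
    by (rule energy_le_lambda_max[OF rooted_star[OF \<open>0 < n\<close>]])
  moreover have "0 < (\<Sum>v<n. (x v)\<^sup>2)"
    unfolding x2 using assms(1) c(1) by (intro add_nonneg_pos) auto
  ultimately show ?thesis by simp
qed

lemma lambda_max_le_star_ge3:
  assumes rooted: "rooted n r par" and "3 \<le> n" "q \<noteq> 0"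
  shows "lambda_max (q_laplacian n q (rtree n r par)) \<le> lambda_max (q_laplacian n q (star_tree n))"
proof -
  define c where "c = \<bar>q\<bar>"
  have "0 < c" using \<open>q \<noteq> 0\<close> by (simp add: c_def)
  define k where "k = real n - 2"
  have "1 \<le> k" using \<open>3 \<le> n\<close> by (simp add: k_def)
  \<comment> \<open>Square root of the discriminant: \<open>m\<close> becomes the larger root of the
    star's quadratic equation.\<close>
  define s where "s = sqrt ((c\<^sup>2 * k)\<^sup>2 + 4 * c\<^sup>2 * (k + 1))"
  have "s\<^sup>2 = (c\<^sup>2 * k)\<^sup>2 + 4 * c\<^sup>2 * (k + 1)" "0 \<le> s"
    using \<open>1 \<le> k\<close> by (simp_all add: s_def)
  define m where "m = (c\<^sup>2 * k + s) / 2"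
  have m: "m\<^sup>2 = c\<^sup>2 * k * m + c\<^sup>2 * (k + 1)"
    using \<open>s\<^sup>2 = _\<close> by (simp add: m_def power2_eq_square field_simps)
  have "0 < m"
    using \<open>0 < c\<close> \<open>1 \<le> k\<close> \<open>0 \<le> s\<close> by (simp add: m_def add_pos_nonneg)
  \<comment> \<open>\<open>c \<le> m\<close> makes \<open>y\<close> monotone in the degree, so that
    a bound on the degree sum bounds the sum of \<open>y\<close> over neighbours.\<close>
  have "c\<^sup>2 \<le> m\<^sup>2"
  proof -
    have "c\<^sup>2 * 1 \<le> c\<^sup>2 * (k + 1)" using \<open>1 \<le> k\<close> by (intro mult_left_mono) auto
    moreover have "0 \<le> c\<^sup>2 * k * m" using \<open>1 \<le> k\<close> \<open>0 < m\<close> by simp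
    ultimately show ?thesis unfolding m by simp
  qed
  then have "c \<le> m" by (rule power2_le_imp_le) (use \<open>0 < m\<close> in simp)
  let ?N = "neighbours n r par"
  let ?d = "\<lambda>i. real (card (?N i))"
  have deg1: "1 \<le> ?d i" if "i < n" for i
    using neighbours_nonempty[OF rooted _ that] \<open>3 \<le> n\<close> by simp
  have N_less: "j < n" if "j \<in> ?N i" for i j using that by (simp add: neighbours_def)
  have sum_deg: "(\<Sum>j\<in>?N i. ?d j) \<le> k + 1" if "i < n" for i
  proof -
    have "real (\<Sum>j\<in>?N i. card (?N j)) \<le> real (n - 1)"
      using sum_degrees_neighbours[OF rooted that] by (rule of_nat_mono)
    then show ?thesis using \<open>3 \<le> n\<close> by (simp add: k_def of_nat_diff)
  qed
  have deg_le: "?d i \<le> k + 1" if "i < n" for i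
  proof -
    have "?d i = (\<Sum>j\<in>?N i. 1)" by simp
    also have "\<dots> \<le> (\<Sum>j\<in>?N i. ?d j)" by (intro sum_mono deg1 N_less)
    finally show ?thesis using sum_deg[OF that] by simp
  qed
  \<comment> \<open>This is \<open>k\<close> times the interpolated star eigenvector:
    \<open>k * c\<close> at degree 1, \<open>k * m\<close> at degree \<open>n - 1\<close>.
    Positivity at the leaves comes from \<open>3 \<le> n\<close>.\<close>
  define y where "y i = k * c + (m - c) * (?d i - 1)" for i
  have super: "c\<^sup>2 * (?d i - 1) * y i + c * (\<Sum>j\<in>?N i. y j) \<le> m * y i" if i: "i < n" for i
  proof -
    define t where "t = ?d i - 1"
    have t: "0 \<le> t" "t \<le> k" using deg1[OF i] deg_le[OF i] by (simp_all add: t_def)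
    have "(\<Sum>j\<in>?N i. y j) = (t + 1) * (k * c) + (m - c) * ((\<Sum>j\<in>?N i. ?d j) - (t + 1))"
      unfolding y_def sum.distrib sum_distrib_left[symmetric] sum_subtractf by (simp add: t_def)
    also have "\<dots> \<le> (t + 1) * (k * c) + (m - c) * (k - t)"
      using sum_deg[OF i] \<open>c \<le> m\<close> by (intro add_left_mono mult_left_mono) auto
    finally have "c * (\<Sum>j\<in>?N i. y j) \<le> c * ((t + 1) * (k * c) + (m - c) * (k - t))"
      using \<open>0 < c\<close> by simp
    moreover have "c\<^sup>2 * t * (k * c + (m - c) * t) + c * ((t + 1) * (k * c) + (m - c) * (k - t))
        \<le> m * (k * c + (m - c) * t)"
    proof -
      \<comment> \<open>The defect is quadratic in \<open>t\<close> and, by the equation for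
        \<open>m\<close>, vanishes at both interpolation points \<open>t = 0\<close> and
        \<open>t = k\<close>.\<close>
      have "m * (k * c + (m - c) * t) -
          (c\<^sup>2 * t * (k * c + (m - c) * t) + c * ((t + 1) * (k * c) + (m - c) * (k - t)))
        = c\<^sup>2 * (m - c) * (t * (k - t)) + t * (m\<^sup>2 - (c\<^sup>2 * k * m + c\<^sup>2 * (k + 1)))"
        by (simp add: power2_eq_square algebra_simps)
      also have "\<dots> = c\<^sup>2 * (m - c) * (t * (k - t))" using m by simp
      also have "\<dots> \<ge> 0" using t \<open>c \<le> m\<close> by simp
      finally show ?thesis by simp
    qed
    ultimately show ?thesis by (simp add: y_def flip: t_def)
  qed
  have pos: "0 < y i" if "i < n" for i
    using \<open>0 < c\<close> \<open>1 \<le> k\<close> \<open>c \<le> m\<close> deg1[OF that] by (simp add: y_def add_pos_nonneg)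
  obtain x where x: "(\<Sum>i<n. (x i)\<^sup>2) = 1"
    "lambda_max (q_laplacian n q (rtree n r par)) \<le> energy n c r par x"
    using lambda_max_rtree_attained[OF rooted, of q] unfolding c_def by blast
  note x(2)
  also have "energy n c r par x \<le> (1 + m) * (\<Sum>i<n. (x i)\<^sup>2)"
    by (rule energy_le_if_supersolution[OF rooted _ pos super]) (use \<open>0 < c\<close> in auto)
  also have "\<dots> = 1 + m" by (simp add: x)
  also have "\<dots> \<le> lambda_max (q_laplacian n q (star_tree n))"
    using m \<open>3 \<le> n\<close> \<open>0 < c\<close>
    by (intro lambda_max_star_lower[of n c]) (auto simp: k_def c_def add.commute)
  finally show ?thesis .
qed

text \<open>For \<open>n \<le> 2\<close> the interpolation degenerates because \<open>n - 2\<close>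
  is not positive, but then the tree is itself the star.\<close>

lemma lambda_max_le_star:
  assumes rooted: "rooted n r par" and "q \<noteq> 0"
  shows "lambda_max (q_laplacian n q (rtree n r par)) \<le> lambda_max (q_laplacian n q (star_tree n))"
proof (cases "3 \<le> n")
  case True
  then show ?thesis using lambda_max_le_star_ge3 assms by blast
next
  case False
  have "0 < n" using rooted_root[OF rooted] by simp
  obtain par' where par': "rooted n 0 par'" "rtree n 0 par' = rtree n r par"
    using reroot[OF rooted \<open>0 < n\<close>] by metis
  have "par' v = 0" if "v < n" "v \<noteq> 0" for v
    using rooted_acyclic(1)[OF par'(1) that] rooted_parent[OF par'(1) that] that False by linarith
  then have "rtree n r par = star_tree n"
    unfolding par'(2)[symmetric] star_tree_rtree[OF \<open>0 < n\<close>] by (rule rtree_cong)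
  then show ?thesis by simp
qed

theorem theorem6p2:
  fixes n :: nat
  shows "(\<forall>T1 T2. tree_on n T1 \<longrightarrow> tree_on n T2 \<longrightarrow> gts_covers n T1 T2 \<longrightarrow>
            (\<forall>q::real. q \<noteq> 0 \<longrightarrow>
               lambda_max (q_laplacian n q T1) \<le> lambda_max (q_laplacian n q T2)))
       \<and> (\<forall>T. tree_on n T \<longrightarrow>
            (\<forall>q::real. q \<noteq> 0 \<longrightarrow>
               lambda_max (q_laplacian n q (path_tree n)) \<le> lambda_max (q_laplacian n q T)
             \<and> lambda_max (q_laplacian n q T) \<le> lambda_max (q_laplacian n q (star_tree n))))"
proof (intro conjI allI impI)
  fix T1 T2 and q :: real
  assume T1: "tree_on n T1" and T2: "tree_on n T2" and "gts_covers n T1 T2"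
  then obtain T where T: "gen_tree_shift\<^sup>*\<^sup>* T1 T" and iso: "digraph_iso T T2"
    by (auto simp: gts_covers_def gts_less_def gts_le_def)
  obtain r par where "rooted n r par" "T1 = rtree n r par"
    using tree_on_rtree[OF T1] .
  then obtain r' par' where T': "rooted n r' par'" "T = rtree n r' par'"
    "lambda_max (q_laplacian n q T1) \<le> lambda_max (q_laplacian n q T)"
    using gen_tree_shifts_rtree T by metis
  have "pair_wf_digraph T"
    using parcs_rtree_subset[OF T'(1)] unfolding T'(2) by unfold_locales auto
  then have "lambda_max (q_laplacian n q T) \<le> lambda_max (q_laplacian n q T2)"
    using iso T'(2) tree_on_facts(1,2)[OF T2] by (intro lambda_max_iso_le) auto
  with T'(3) show "lambda_max (q_laplacian n q T1) \<le> lambda_max (q_laplacian n q T2)"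
    by simp
next
  fix T and q :: real
  assume "tree_on n T" "q \<noteq> 0"
  then obtain r par where T: "rooted n r par" "T = rtree n r par"
    using tree_on_rtree by metis
  show "lambda_max (q_laplacian n q (path_tree n)) \<le> lambda_max (q_laplacian n q T)"
    unfolding T(2) by (rule lambda_max_path_le[OF T(1)])
  show "lambda_max (q_laplacian n q T) \<le> lambda_max (q_laplacian n q (star_tree n))"
    unfolding T(2) by (rule lambda_max_le_star[OF T(1) \<open>q \<noteq> 0\<close>])
qed

end
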